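(* Consider a smooth pure exchange economy with $m$ consumers and $l$ goods, reduced excess demand $\bar z\colon S\times\Omega\to\mathbb R^{l-1}$, equilibrium manifold $E=\bar z^{-1}(0)\subset S\times\Omega$ and natural projection $\pi\colon E\to\Omega$ (all as defined in the context). Given a point $e=(p,\omega)\in E$, the inclusion $i(v):=(v,0)$ sends $\operatorname{Ker}D\bar z_\omega(p)$ isomorphically onto $\operatorname{Ker}D\pi(e)$. In particular, $e=(p,\omega)$ is a critical point of $\pi$ if and only if $p$ is a critical point of $\bar z_\omega$. Moreover, there exists a canonical isomorphism $j\colon\operatorname{Coker}D\bar z_\omega(p)\to\operatorname{Coker}D\pi(e)$ (described in the context) such that for every $v\in\operatorname{Ker}D\bar z_\omega(p)$, $$\partial^2_{i(v)}\pi(e)=j\,\partial^2_v\bar z_\omega(p),$$ where the kernels are identified through $i$, i.e. $\partial^2_{i(v)}\pi(e)\,i(u)=j\big(\partial^2_v\bar z_\omega(p)\,u\big)$ for all $u\in\operatorname{Ker}D\bar z_\omega(p)$.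
   Context: Economy. $X=\mathbb R^l_{++}$ is the strictly positive orthant; $S=\{(p_1,\dots,p_l)\in\mathbb R^l_{++} : p_l=1\}$ is the set of normalized prices, identified with an open subset of $\mathbb R^{l-1}$. Each consumer $i=1,\dots,m$ has a fixed smooth utility function $u_i\colon X\to\mathbb R$ such that: (monotonicity) $\nabla u_i(x)\in\mathbb R^l_{++}$ for every $x\in X$; (strict quasi-concavity) the Hessian $D^2u_i(x)$ is negative definite on the tangent hyperplane at $x$ to the indifference surface through $x$; (necessity) for every $r\in\mathbb R$ the indifference surface $\{x\in X: u_i(x)=r\}$ is closed in $\mathbb R^l$. For an endowment $\omega_i\in X$ and $p\in S$, the demand $x_i(p,\omega_i)\in X$ is the unique maximizer of $u_i$ on $\{x\in X: p\cdot x\le p\cdot\omega_i\}$; it satisfies $p\cdot x_i(p,\omega_i)=p\cdot\omega_i$ and depends smoothly on $(p,\omega_i)$. An economy is $\omega=(\omega_1,\dots,\omega_m)\in\Omega=\mathbb R^{ml}_{++}$. The excess demand is $z\colon S\times\Omega\to\mathbb R^l$, $z(p,\omega)=\sum_{i=1}^m(x_i(p,\omega_i)-\omega_i)$; it satisfies $p\cdot z(p,\omega)=0$. The reduced excess demand $\bar z\colon S\times\Omega\to\mathbb R^{l-1}$ is obtained from $z$ by deleting the last coordinate, and $\bar z_\omega(p)=\bar z(p,\omega)$. The equilibrium manifold is $E=\{(p,\omega)\in S\times\Omega: z(p,\omega)=0\}=\bar z^{-1}(0)$; $0$ is a regular value of $\bar z$, so $E$ is a smooth $ml$-dimensional submanifold.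 The natural projection is $\pi\colon E\to\Omega$, $\pi(p,\omega)=\omega$, the restriction of $\Pi\colon S\times\Omega\to\Omega$. A critical point of a map between manifolds of the same dimension is a point where the differential is not an isomorphism. Canonical isomorphism. Let $g=(\Pi,\bar z)\colon S\times\Omega\to\Omega\times\mathbb R^{l-1}$. The inclusions $\mathbb R^{ml}\times\{0\}\subset\mathbb R^{ml}\times\mathbb R^{l-1}$ and $\{0\}\times\mathbb R^{l-1}\subset\mathbb R^{ml}\times\mathbb R^{l-1}$ induce maps $j_1\colon\operatorname{Coker}D\pi(e)\to\operatorname{Coker}Dg(e)$ and $j_2\colon\operatorname{Coker}D\bar z_\omega(p)\to\operatorname{Coker}Dg(e)$, which are isomorphisms; the canonical isomorphism is $j=j_1^{-1}j_2$. Intrinsic derivative. Let $\psi\colon F\to F'$ be a morphism of smooth vector bundles over a manifold $M$, $x\in M$, $v\in T_x(M)$. Choose trivializations of $F,F'$ over a neighbourhood of $x$ with fibres $F_x,F'_x$, equal to the identity at $x$; in them $\psi$ becomes a smooth map $L$ into $\operatorname{Hom}(F_x,F'_x)$ with $L(x)=\psi_x$. With $l(t)=L(\exp(tv))$, where $\exp$ is any exponential map at $x$, the intrinsic derivative is $\partial_v\psi(x)=k\,\dot l(0)\,\iota\colon\operatorname{Ker}\psi_x\to\operatorname{Coker}\psi_x$, where $\iota$ is the inclusion of the kernel and $k$ the projection to the cokernel. It is independent of the choices. For a smooth map $f\colon M\to N$ regard $Df$ as a bundle morphism $T(M)\to f^*T(N)$; the intrinsic second derivative is $\partial_v^2f(x)=\partial_v(Df)(x)\colon\operatorname{Ker}Df(x)\to\operatorname{Coker}Df(x)$.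 *)

theory Defs
  imports "HOL-Analysis.Analysis" "HOL-Library.Set_Algebras"
begin

section \<open>Smooth maps, tangent spaces and differentials\<close>

text \<open>Manifolds are subsets of Euclidean spaces. \<open>Ck_on\<close> is meant for open sets; a map on an
  arbitrary subset is smooth if locally it extends to a smooth map on an open set of the ambient
  space.\<close>

primrec Ck_on :: "nat \<Rightarrow> 'a::euclidean_space set \<Rightarrow> ('a \<Rightarrow> 'b::euclidean_space) \<Rightarrow> bool" where
  "Ck_on 0 U f \<longleftrightarrow> continuous_on U f"
| "Ck_on (Suc k) U f \<longleftrightarrow>
     (\<forall>x\<in>U. f differentiable (at x)) \<and> (\<forall>v. Ck_on k U (\<lambda>x. frechet_derivative f (at x) v))"

definition smooth_on :: "'a::euclidean_space set \<Rightarrow> ('a \<Rightarrow> 'b::euclidean_space) \<Rightarrow> bool" where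
  "smooth_on M f \<longleftrightarrow>
     (\<forall>x\<in>M. \<exists>U h. open U \<and> x \<in> U \<and> (\<forall>k. Ck_on k U h) \<and> (\<forall>y\<in>M \<inter> U. h y = f y))"

definition tangent_space :: "'a::euclidean_space set \<Rightarrow> 'a \<Rightarrow> 'a set" where
  "tangent_space M x =
     {v. \<exists>\<gamma> \<delta>. 0 < \<delta> \<and> smooth_on {-\<delta><..<\<delta>} \<gamma> \<and> \<gamma> ` {-\<delta><..<\<delta>} \<subseteq> M \<and>
           \<gamma> (0::real) = x \<and> (\<gamma> has_vector_derivative v) (at 0)}"

text \<open>A derivative within \<open>M\<close> is determined only on tangent vectors of \<open>M\<close>, so
  \<open>differential M f x\<close> is to be applied to elements of \<open>tangent_space M x\<close> only.\<close>

definition differential ::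
    "'a::euclidean_space set \<Rightarrow> ('a \<Rightarrow> 'b::euclidean_space) \<Rightarrow> 'a \<Rightarrow> 'a \<Rightarrow> 'b" where
  "differential M f x = frechet_derivative f (at x within M)"

definition critical_point ::
    "'a::euclidean_space set \<Rightarrow> 'b::euclidean_space set \<Rightarrow> ('a \<Rightarrow> 'b) \<Rightarrow> 'a \<Rightarrow> bool" where
  "critical_point M N f x \<longleftrightarrow>
     \<not> bij_betw (differential M f x) (tangent_space M x) (tangent_space N (f x))"


section \<open>Kernels and cokernels\<close>

text \<open>A linear map between subspaces \<open>V\<close> and \<open>W\<close> is the restriction of a function between the
  ambient spaces. Elements of a cokernel are the cosets of the image in \<open>W\<close>.\<close>

definition ker_on :: "'a set \<Rightarrow> ('a \<Rightarrow> 'b::zero) \<Rightarrow> 'a set" where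
  "ker_on V A = {v \<in> V. A v = 0}"

definition coker_on :: "'a set \<Rightarrow> 'b::real_vector set \<Rightarrow> ('a \<Rightarrow> 'b) \<Rightarrow> 'b set set" where
  "coker_on V W A = (\<lambda>w. w +o A ` V) ` W"

definition Ker :: "'a::euclidean_space set \<Rightarrow> ('a \<Rightarrow> 'b::euclidean_space) \<Rightarrow> 'a \<Rightarrow> 'a set" where
  "Ker M f x = ker_on (tangent_space M x) (differential M f x)"

definition Img :: "'a::euclidean_space set \<Rightarrow> ('a \<Rightarrow> 'b::euclidean_space) \<Rightarrow> 'a \<Rightarrow> 'b set" where
  "Img M f x = differential M f x ` tangent_space M x"

definition Coker ::
    "'a::euclidean_space set \<Rightarrow> 'b::euclidean_space set \<Rightarrow> ('a \<Rightarrow> 'b) \<Rightarrow> 'a \<Rightarrow> 'b set set" where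
  "Coker M N f x = coker_on (tangent_space M x) (tangent_space N (f x)) (differential M f x)"

text \<open>Linear isomorphisms between spaces of cosets \<open>Q\<close> of \<open>K\<close> and \<open>Q'\<close> of \<open>K'\<close>. Cosets are added
  as sets; the summand \<open>K\<close> in the scalar multiple matters for the scalar \<open>0\<close>.\<close>

definition scale_coset :: "'a::real_vector set \<Rightarrow> real \<Rightarrow> 'a set \<Rightarrow> 'a set" where
  "scale_coset K r C = (*\<^sub>R) r ` C + K"

definition quotient_iso ::
    "'a::real_vector set \<Rightarrow> 'a set set \<Rightarrow> 'b::real_vector set \<Rightarrow> 'b set set \<Rightarrow> ('a set \<Rightarrow> 'b set) \<Rightarrow> bool"
  where
  "quotient_iso K Q K' Q' j \<longleftrightarrow>
     bij_betw j Q Q' \<and>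
     (\<forall>C\<in>Q. \<forall>D\<in>Q. j (C + D) = j C + j D) \<and>
     (\<forall>r. \<forall>C\<in>Q. j (scale_coset K r C) = scale_coset K' r (j C))"

text \<open>The map \<open>w + K \<mapsto> T w + K'\<close> of quotients induced by a linear map \<open>T\<close> with \<open>T ` K \<subseteq> K'\<close>.\<close>

definition induced_map :: "'b::real_vector set \<Rightarrow> ('a \<Rightarrow> 'b) \<Rightarrow> 'a set \<Rightarrow> 'b set" where
  "induced_map K' T C = T ` C + K'"


section \<open>Intrinsic derivatives\<close>

text \<open>A vector bundle over \<open>M\<close> is a family of linear subspaces \<open>F y\<close>, \<open>y \<in> M\<close>, of a Euclidean space.
  A trivialization near \<open>x\<close> with fibre \<open>F x\<close> is written as the family of
  isomorphisms \<open>\<tau> y : F x \<rightarrow> F y\<close>; only the values of \<open>\<tau> y\<close> on \<open>F x\<close> matter.\<close>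

definition local_trivialization ::
    "'a::euclidean_space set \<Rightarrow> ('a \<Rightarrow> 'b::euclidean_space set) \<Rightarrow> 'a \<Rightarrow> ('a \<Rightarrow> 'b \<Rightarrow> 'b) \<Rightarrow> bool" where
  "local_trivialization M F x \<tau> \<longleftrightarrow>
     (\<exists>U. open U \<and> x \<in> U \<and>
        (\<forall>y\<in>M \<inter> U. linear (\<tau> y) \<and> bij_betw (\<tau> y) (F x) (F y)) \<and>
        (\<forall>a\<in>F x. smooth_on (M \<inter> U) (\<lambda>y. \<tau> y a))) \<and>
     (\<forall>a\<in>F x. \<tau> x a = a)"

text \<open>Of an exponential map at \<open>x\<close>, only the following properties are required: it is a smooth map
  into \<open>M\<close> on a neighbourhood of \<open>0\<close> in the tangent space, sends \<open>0\<close> to \<open>x\<close>, and its differential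
  at \<open>0\<close> is the identity.\<close>

definition exponential_map :: "'a::euclidean_space set \<Rightarrow> 'a \<Rightarrow> ('a \<Rightarrow> 'a) \<Rightarrow> bool" where
  "exponential_map M x \<epsilon> \<longleftrightarrow>
     (\<exists>r>0. smooth_on (tangent_space M x \<inter> ball 0 r) \<epsilon> \<and> \<epsilon> ` (tangent_space M x \<inter> ball 0 r) \<subseteq> M) \<and>
     \<epsilon> 0 = x \<and> (\<epsilon> has_derivative (\<lambda>v. v)) (at 0 within tangent_space M x)"

text \<open>For a bundle morphism \<open>\<psi> y : F y \<rightarrow> F' y\<close>, the map \<open>L y : F x \<rightarrow> F' x\<close> is \<open>\<psi>\<close> in the
  trivializations \<open>\<tau>\<close> and \<open>\<tau>'\<close>.\<close>

definition in_trivializations ::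
    "('a \<Rightarrow> 'c set) \<Rightarrow> 'a \<Rightarrow> ('a \<Rightarrow> 'b \<Rightarrow> 'b) \<Rightarrow> ('a \<Rightarrow> 'c \<Rightarrow> 'c) \<Rightarrow> ('a \<Rightarrow> 'b \<Rightarrow> 'c) \<Rightarrow> 'a \<Rightarrow> 'b \<Rightarrow> 'c" where
  "in_trivializations F' x \<tau> \<tau>' \<psi> y a = inv_into (F' x) (\<tau>' y) (\<psi> y (\<tau> y a))"

text \<open>The value at \<open>a\<close> in the kernel of \<open>\<psi> x\<close> of the intrinsic derivative of \<open>\<psi>\<close> at \<open>x\<close> in the
  direction \<open>v\<close>. The definite description expresses independence of the choices.\<close>

definition intrinsic_derivative ::
    "'a::euclidean_space set \<Rightarrow> ('a \<Rightarrow> 'b::euclidean_space set) \<Rightarrow> ('a \<Rightarrow> 'c::euclidean_space set) \<Rightarrow>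
     ('a \<Rightarrow> 'b \<Rightarrow> 'c) \<Rightarrow> 'a \<Rightarrow> 'a \<Rightarrow> 'b \<Rightarrow> 'c set" where
  "intrinsic_derivative M F F' \<psi> x v a =
     (THE C. \<exists>\<tau> \<tau>' \<epsilon> d.
        local_trivialization M F x \<tau> \<and> local_trivialization M F' x \<tau>' \<and> exponential_map M x \<epsilon> \<and>
        ((\<lambda>t. in_trivializations F' x \<tau> \<tau>' \<psi> (\<epsilon> (t *\<^sub>R v)) a) has_vector_derivative d) (at (0::real)) \<and>
        C = d +o \<psi> x ` F x)"

definition intrinsic_second_derivative ::
    "'a::euclidean_space set \<Rightarrow> 'b::euclidean_space set \<Rightarrow> ('a \<Rightarrow> 'b) \<Rightarrow> 'a \<Rightarrow> 'a \<Rightarrow> 'a \<Rightarrow> 'b set" where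
  "intrinsic_second_derivative M N f x v a =
     intrinsic_derivative M (tangent_space M) (\<lambda>y. tangent_space N (f y)) (differential M f) x v a"


section \<open>Exchange economies\<close>

definition goods_space :: "(real ^ 'l) set" where
  "goods_space = {x. \<forall>k. 0 < x $ k}"

definition gradient :: "(real ^ 'l \<Rightarrow> real) \<Rightarrow> real ^ 'l \<Rightarrow> real ^ 'l" where
  "gradient f x = (\<chi> k. frechet_derivative f (at x) (axis k 1))"

definition hessian :: "(real ^ 'l \<Rightarrow> real) \<Rightarrow> real ^ 'l \<Rightarrow> real ^ 'l ^ 'l" where
  "hessian f x = (\<chi> a b. gradient (\<lambda>y. gradient f y $ b) x $ a)"

text \<open>The tangent hyperplane at \<open>x\<close> to the indifference surface through \<open>x\<close> is the orthogonal
  complement of the gradient.\<close>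

definition utility_function :: "(real ^ 'l \<Rightarrow> real) \<Rightarrow> bool" where
  "utility_function f \<longleftrightarrow>
     smooth_on goods_space f \<and>
     (\<forall>x\<in>goods_space. gradient f x \<in> goods_space) \<and>
     (\<forall>x\<in>goods_space. \<forall>v. gradient f x \<bullet> v = 0 \<and> v \<noteq> 0 \<longrightarrow> v \<bullet> (hessian f x *v v) < 0) \<and>
     (\<forall>r. closed {x \<in> goods_space. f x = r})"

definition demand :: "(real ^ 'l \<Rightarrow> real) \<Rightarrow> real ^ 'l \<Rightarrow> real ^ 'l \<Rightarrow> real ^ 'l" where
  "demand f p w = (THE x. is_arg_max f (\<lambda>y. y \<in> goods_space \<and> p \<bullet> y \<le> p \<bullet> w) x)"

definition endowments :: "(real ^ 'l ^ 'm) set" where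
  "endowments = {\<omega>. \<forall>i. \<omega> $ i \<in> goods_space}"

text \<open>The parameter \<open>n\<close> is the good whose price is normalized (the last one in an enumeration of the
  goods). \<open>\<real>\<^bsup>l-1\<^esup>\<close> is the coordinate hyperplane \<open>reduced_space n\<close>, and deleting the last
  coordinate is the projection onto it; in this way a single good is not excluded.\<close>

definition prices :: "'l \<Rightarrow> (real ^ 'l) set" where
  "prices n = {p \<in> goods_space. p $ n = 1}"

definition reduced_space :: "'l \<Rightarrow> (real ^ 'l) set" where
  "reduced_space n = {y. y $ n = 0}"

definition excess_demand ::
    "('m::finite \<Rightarrow> real ^ 'l \<Rightarrow> real) \<Rightarrow> real ^ 'l \<Rightarrow> real ^ 'l ^ 'm \<Rightarrow> real ^ 'l" where
  "excess_demand u p \<omega> = (\<Sum>i\<in>UNIV. demand (u i) p (\<omega> $ i) - \<omega> $ i)"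

definition reduced_excess_demand ::
    "('m::finite \<Rightarrow> real ^ 'l \<Rightarrow> real) \<Rightarrow> 'l \<Rightarrow> real ^ 'l ^ 'm \<Rightarrow> real ^ 'l \<Rightarrow> real ^ 'l" where
  "reduced_excess_demand u n \<omega> p = (\<chi> k. if k = n then 0 else excess_demand u p \<omega> $ k)"

definition equilibrium_manifold ::
    "('m::finite \<Rightarrow> real ^ 'l \<Rightarrow> real) \<Rightarrow> 'l \<Rightarrow> ((real ^ 'l) \<times> (real ^ 'l ^ 'm)) set" where
  "equilibrium_manifold u n =
     {(p, \<omega>). p \<in> prices n \<and> \<omega> \<in> endowments \<and> excess_demand u p \<omega> = 0}"

definition natural_projection :: "(real ^ 'l) \<times> (real ^ 'l ^ 'm) \<Rightarrow> real ^ 'l ^ 'm" where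
  "natural_projection = snd"

definition graph_map ::
    "('m::finite \<Rightarrow> real ^ 'l \<Rightarrow> real) \<Rightarrow> 'l \<Rightarrow> (real ^ 'l) \<times> (real ^ 'l ^ 'm) \<Rightarrow> (real ^ 'l ^ 'm) \<times> (real ^ 'l)" where
  "graph_map u n = (\<lambda>(p, \<omega>). (\<omega>, reduced_excess_demand u n \<omega> p))"

text \<open>The maps \<open>j\<^sub>1\<close> and \<open>j\<^sub>2\<close> induced by the inclusions of the factors into
  \<open>\<real>\<^bsup>ml\<^esup> \<times> \<real>\<^bsup>l-1\<^esup>\<close>, and the canonical map \<open>j = j\<^sub>1\<^sup>-\<^sup>1 j\<^sub>2\<close>.\<close>

definition j1 ::
    "('m::finite \<Rightarrow> real ^ 'l \<Rightarrow> real) \<Rightarrow> 'l \<Rightarrow> (real ^ 'l) \<times> (real ^ 'l ^ 'm) \<Rightarrow>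
     (real ^ 'l ^ 'm) set \<Rightarrow> ((real ^ 'l ^ 'm) \<times> (real ^ 'l)) set" where
  "j1 u n e = induced_map (Img (prices n \<times> endowments) (graph_map u n) e) (\<lambda>a. (a, 0))"

definition j2 ::
    "('m::finite \<Rightarrow> real ^ 'l \<Rightarrow> real) \<Rightarrow> 'l \<Rightarrow> (real ^ 'l) \<times> (real ^ 'l ^ 'm) \<Rightarrow>
     (real ^ 'l) set \<Rightarrow> ((real ^ 'l ^ 'm) \<times> (real ^ 'l)) set" where
  "j2 u n e = induced_map (Img (prices n \<times> endowments) (graph_map u n) e) (\<lambda>b. (0, b))"

definition canonical_map ::
    "('m::finite \<Rightarrow> real ^ 'l \<Rightarrow> real) \<Rightarrow> 'l \<Rightarrow> (real ^ 'l) \<times> (real ^ 'l ^ 'm) \<Rightarrow>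
     (real ^ 'l) set \<Rightarrow> (real ^ 'l ^ 'm) set" where
  "canonical_map u n e =
     inv_into (Coker (equilibrium_manifold u n) endowments natural_projection e) (j1 u n e) \<circ> j2 u n e"

end

theory Submission
  imports Defs
begin

text \<open>
  The first-order conditions identify demand with the inverse of a smooth bijection between open
  sets whose derivative is injective, so demand is smooth. If the excess demand is handed to one
  consumer, all incomes and hence all demands stay the same while the markets clear; this is a
  smooth retraction \<open>r\<close> of a neighbourhood onto the equilibrium manifold \<open>E\<close>. The derivatives
  \<open>Dr(y)\<close>, \<open>y \<in> E\<close>, are the projections onto the tangent spaces and trivialize the tangent bundle
  near a point, and \<open>v \<mapsto> r (e + v)\<close> is an exponential map.

  With \<open>A = D z(e)\<close> for the reduced excess demand \<open>z\<close> as a function of prices and endowments, the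
  tangent space of \<open>E\<close> at \<open>e\<close> is the kernel of \<open>A\<close>, and \<open>A\<close> is onto already on endowment
  directions. The statements on kernels and cokernels are linear algebra for \<open>A\<close>. For the second
  derivatives, let \<open>y(t)\<close> be a curve in \<open>E\<close> with velocity \<open>(v, 0)\<close> and \<open>b(t)\<close> a tangent field along
  it with \<open>b(0) = (w, 0)\<close>. Differentiating \<open>D z(y(t)) b(t) = 0\<close> gives
  \<open>D\<^sup>2 z(e) (v, 0) (w, 0) + A b'(0) = 0\<close>, so \<open>(b'(0)\<^sub>2, 0)\<close> and \<open>(0, D\<^sup>2 z(e) (v, 0) (w, 0))\<close> differ by
  \<open>Dg(e) b'(0)\<close>, while \<open>b'(0)\<^sub>2\<close> represents the intrinsic second derivative of the projection.\<close>

section \<open>Maps of class \<open>C\<^sup>k\<close>\<close>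

text \<open>Demand is given as a maximizer, differentials by choice and intrinsic derivatives by a
  definite description, so each is first turned into something computable. Normalized prices and the
  equilibrium manifold are not open; excess demand is therefore extended to a smooth map
  \<open>Z\<close> on an open set, where ordinary derivatives exist. Charts are replaced throughout
  by retractions. A trivialization and an exponential map have to be exhibited because the definite
  description names nothing unless some admissible choice exists. That its value is the same for all
  choices rests on two cancellations. The argument lies in the kernel, so the trivialization of the
  target, being the identity at the base point, contributes no derivative term. A change of the
  tangent field along the curve alters the result by an element of the image, which the cokernel
  forgets. What remains is one computation along an arbitrary curve with an arbitrary tangent field,
  for each of the two maps.\<close>

lemma Ck_on_cong:
  assumes "open U" "\<And>x. x \<in> U \<Longrightarrow> f x = g x" "Ck_on k U f"
  shows "Ck_on k U g"
  using assms
proof (induction k arbitrary: f g)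
  case 0
  then show ?case using continuous_on_cong[of U U f g] by simp
next
  case (Suc k)
  have d: "(g has_derivative frechet_derivative f (at x)) (at x)" if "x \<in> U" for x
  proof -
    have "(f has_derivative frechet_derivative f (at x)) (at x)"
      using Suc.prems that frechet_derivative_works by auto
    then show ?thesis
      using has_derivative_transform_within_open[OF _ Suc.prems(1) that] Suc.prems(2) by blast
  qed
  then have e: "frechet_derivative f (at x) = frechet_derivative g (at x)" if "x \<in> U" for x
    using frechet_derivative_at that by metis
  show ?case
    unfolding Ck_on.simps
  proof (intro conjI ballI allI)
    show "g differentiable at x" if "x \<in> U" for x
      using d[OF that] differentiable_def by blast
    show "Ck_on k U (\<lambda>x. frechet_derivative g (at x) v)" for v
    proof (rule Suc.IH[OF Suc.prems(1)])
      show "Ck_on k U (\<lambda>x. frechet_derivative f (at x) v)"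
        using Suc.prems(3) by simp
    qed (use e in simp)
  qed
qed

text \<open>The recursion is phrased through the chosen \<open>frechet_derivative\<close>; this rule
  accepts any derivative formula, so that product and chain rules feed an induction on the order
  directly.\<close>

lemma Ck_on_SucI:
  assumes "open U" "\<And>x. x \<in> U \<Longrightarrow> (f has_derivative f' x) (at x)" "\<And>v. Ck_on k U (\<lambda>x. f' x v)"
  shows "Ck_on (Suc k) U f"
  unfolding Ck_on.simps
proof (intro conjI ballI allI)
  show "f differentiable at x" if "x \<in> U" for x
    using assms(2)[OF that] differentiable_def by blast
  show "Ck_on k U (\<lambda>x. frechet_derivative f (at x) v)" for v
    using Ck_on_cong[OF assms(1) _ assms(3)[of v]] frechet_derivative_at[OF assms(2)] by simp
qed

lemma Ck_on_has_derivative: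
  assumes "Ck_on (Suc k) U f" "x \<in> U"
  shows "(f has_derivative frechet_derivative f (at x)) (at x)"
  using assms frechet_derivative_works by auto

lemma Ck_on_frechet_derivative:
  "Ck_on (Suc k) U f \<Longrightarrow> Ck_on k U (\<lambda>x. frechet_derivative f (at x) v)"
  by simp

lemma Ck_on_Suc_imp: "Ck_on (Suc k) U f \<Longrightarrow> Ck_on k U f"
proof (induction k arbitrary: f)
  case 0
  then show ?case
    by (simp add: continuous_at_imp_continuous_on differentiable_imp_continuous_within)
next
  case (Suc k)
  then show ?case by (metis Ck_on.simps(2))
qed

lemma Ck_on_imp_continuous_on: "Ck_on k U f \<Longrightarrow> continuous_on U f"
  by (induction k) (auto dest: Ck_on_Suc_imp simp del: Ck_on.simps(2))

lemma Ck_on_subset: "Ck_on k U f \<Longrightarrow> V \<subseteq> U \<Longrightarrow> Ck_on k V f"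
  by (induction k arbitrary: f) (auto intro: continuous_on_subset)

lemma Ck_on_local:
  assumes "\<And>x. x \<in> U \<Longrightarrow> \<exists>V. open V \<and> x \<in> V \<and> Ck_on k V f"
  shows "Ck_on k U f"
  using assms
proof (induction k arbitrary: f)
  case 0
  then show ?case
    by (intro continuous_at_imp_continuous_on ballI Ck_on.simps(1)[THEN iffD2])
      (metis Ck_on.simps(1) continuous_on_eq_continuous_at)
next
  case (Suc k)
  show ?case unfolding Ck_on.simps
  proof (intro conjI ballI allI)
    show "f differentiable at x" if "x \<in> U" for x
      using Suc.prems[OF that] by auto
    show "Ck_on k U (\<lambda>x. frechet_derivative f (at x) v)" for v
      by (rule Suc.IH) (metis Suc.prems Ck_on.simps(2))
  qed
qed

lemma Ck_on_const [intro]: "open U \<Longrightarrow> Ck_on k U (\<lambda>x. c)"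
proof (induction k arbitrary: c)
  case (Suc k)
  show ?case
    by (rule Ck_on_SucI[OF Suc.prems, of _ "\<lambda>x v. 0"]) (use Suc in auto)
qed simp

lemma Ck_on_bounded_linear:
  assumes "bounded_linear L" "open U" "Ck_on k U f"
  shows "Ck_on k U (\<lambda>x. L (f x))"
  using assms(3)
proof (induction k arbitrary: f)
  case 0
  then show ?case using assms(1) bounded_linear.continuous_on by auto
next
  case (Suc k)
  show ?case
    by (rule Ck_on_SucI[OF assms(2) bounded_linear.has_derivative[OF assms(1) Ck_on_has_derivative[OF Suc.prems]]])
      (assumption, intro Suc.IH Ck_on_frechet_derivative[OF Suc.prems])
qed

lemma Ck_on_id: "open U \<Longrightarrow> Ck_on k U (\<lambda>x. x)"
  by (cases k) (auto intro!: Ck_on_SucI[of _ _ "\<lambda>x v. v"] simp del: Ck_on.simps(2))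

lemma Ck_on_linear: "open U \<Longrightarrow> linear f \<Longrightarrow> Ck_on k U f"
  using Ck_on_bounded_linear[OF linear_conv_bounded_linear[THEN iffD1] _ Ck_on_id] by auto

lemma Ck_on_add:
  assumes "open U" "Ck_on k U f" "Ck_on k U g"
  shows "Ck_on k U (\<lambda>x. f x + g x)"
  using assms(2,3)
proof (induction k arbitrary: f g)
  case 0
  then show ?case by (auto intro: continuous_on_add)
next
  case (Suc k)
  show ?case
    by (rule Ck_on_SucI[OF assms(1) has_derivative_add[OF Suc.prems[THEN Ck_on_has_derivative]]])
      (auto intro!: Suc.IH Suc.prems[THEN Ck_on_frechet_derivative])
qed

lemma Ck_on_minus: "open U \<Longrightarrow> Ck_on k U f \<Longrightarrow> Ck_on k U (\<lambda>x. - f x)"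
  by (rule Ck_on_bounded_linear[OF bounded_linear_minus[OF bounded_linear_ident]])

lemma Ck_on_diff:
  assumes "open U" "Ck_on k U f" "Ck_on k U g"
  shows "Ck_on k U (\<lambda>x. f x - g x)"
  using Ck_on_add[OF assms(1,2) Ck_on_minus[OF assms(1,3)]] by simp

lemma Ck_on_sum:
  assumes "open U" "\<And>i. i \<in> I \<Longrightarrow> Ck_on k U (f i)"
  shows "Ck_on k U (\<lambda>x. \<Sum>i\<in>I. f i x)"
  using assms(2)
  by (induction I rule: infinite_finite_induct) (auto intro: Ck_on_const Ck_on_add assms(1))

lemma Ck_on_bilinear:
  fixes f :: "'d::euclidean_space \<Rightarrow> 'a::euclidean_space" and g :: "'d \<Rightarrow> 'b::euclidean_space"
    and P :: "'a \<Rightarrow> 'b \<Rightarrow> 'c::euclidean_space"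
  assumes "bounded_bilinear P" "open U" "Ck_on k U f" "Ck_on k U g"
  shows "Ck_on k U (\<lambda>x. P (f x) (g x))"
  using assms(3,4)
proof (induction k arbitrary: f g)
  case 0
  then show ?case using assms(1) by (auto intro: bounded_bilinear.continuous_on)
next
  case (Suc k)
  show ?case
    by (rule Ck_on_SucI[OF assms(2) bounded_bilinear.FDERIV[OF assms(1) Suc.prems[THEN Ck_on_has_derivative]]])
      (auto intro!: Suc.IH Ck_on_add assms(2) Suc.prems[THEN Ck_on_frechet_derivative]
        Suc.prems[THEN Ck_on_Suc_imp])
qed

lemmas Ck_on_scaleR = Ck_on_bilinear[OF bounded_bilinear_scaleR]
lemmas Ck_on_mult = Ck_on_bilinear[OF bounded_bilinear_mult[where 'a = real]]
lemmas Ck_on_inner = Ck_on_bilinear[OF bounded_bilinear_inner]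

lemma Ck_on_prod:
  fixes f :: "'i \<Rightarrow> 'd::euclidean_space \<Rightarrow> real"
  assumes "open U" "\<And>i. i \<in> I \<Longrightarrow> Ck_on k U (f i)"
  shows "Ck_on k U (\<lambda>x. \<Prod>i\<in>I. f i x)"
  using assms(2)
  by (induction I rule: infinite_finite_induct) (auto intro: Ck_on_const Ck_on_mult assms(1))

lemma Ck_on_vec:
  fixes f :: "'d::euclidean_space \<Rightarrow> 'c::euclidean_space ^ 'i::finite"
  assumes "open U" "\<And>i. Ck_on k U (\<lambda>x. f x $ i)"
  shows "Ck_on k U f"
proof -
  have lin: "bounded_linear (axis i :: 'c \<Rightarrow> 'c ^ 'i)" for i
    by (intro linear_conv_bounded_linear[THEN iffD1] linearI)
      (auto simp: vec_eq_iff axis_def)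
  have eq: "(\<Sum>i\<in>UNIV. axis i (f x $ i)) = f x" for x
    by (auto simp: vec_eq_iff axis_def if_distrib cong: if_cong)
  have "Ck_on k U (\<lambda>x. \<Sum>i\<in>UNIV. axis i (f x $ i))"
    by (intro Ck_on_sum Ck_on_bounded_linear[OF lin] assms)
  then show ?thesis by (simp add: eq)
qed

lemma Ck_on_vec_nth:
  fixes f :: "'d::euclidean_space \<Rightarrow> 'c::euclidean_space ^ 'i::finite"
  shows "open U \<Longrightarrow> Ck_on k U f \<Longrightarrow> Ck_on k U (\<lambda>x. f x $ i)"
  by (rule Ck_on_bounded_linear[OF bounded_linear_vec_nth])

lemma Ck_on_Pair:
  assumes "open U" "Ck_on k U f" "Ck_on k U g"
  shows "Ck_on k U (\<lambda>x. (f x, g x))"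
proof -
  have "Ck_on k U (\<lambda>x. (f x, 0) + (0, g x))"
    by (intro Ck_on_add Ck_on_bounded_linear[of "\<lambda>a. (a, 0)"] Ck_on_bounded_linear[of "\<lambda>a. (0, a)"]
      bounded_linear_Pair bounded_linear_ident bounded_linear_zero assms)
  then show ?thesis by simp
qed

lemma linear_eq_sum_Basis:
  fixes v :: "'a::euclidean_space"
  assumes "linear L"
  shows "L v = (\<Sum>b\<in>Basis. (v \<bullet> b) *\<^sub>R L b)"
proof -
  have "L v = L (\<Sum>b\<in>Basis. (v \<bullet> b) *\<^sub>R b)" by (simp add: euclidean_representation)
  also have "\<dots> = (\<Sum>b\<in>Basis. (v \<bullet> b) *\<^sub>R L b)"
    using assms by (simp only: linear_sum linear_cmul o_def)
  finally show ?thesis .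
qed

text \<open>\<open>Ck_on\<close> controls the derivative only in fixed directions; expanding the
  moving direction \<open>c x\<close> in the basis reduces to these.\<close>

lemma Ck_on_frechet_derivative_apply:
  fixes g :: "'a::euclidean_space \<Rightarrow> 'b::euclidean_space" and f :: "'d::euclidean_space \<Rightarrow> 'a"
  assumes "open U" "f ` U \<subseteq> V" "\<And>y. y \<in> V \<Longrightarrow> g differentiable (at y)"
    "\<And>b. Ck_on k U (\<lambda>x. frechet_derivative g (at (f x)) b)" "Ck_on k U c"
  shows "Ck_on k U (\<lambda>x. frechet_derivative g (at (f x)) (c x))"
proof -
  have "Ck_on k U (\<lambda>x. \<Sum>b\<in>Basis. (c x \<bullet> b) *\<^sub>R frechet_derivative g (at (f x)) b)"
    by (intro Ck_on_sum Ck_on_scaleR Ck_on_inner Ck_on_const assms)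
  then show ?thesis
    by (rule Ck_on_cong[OF assms(1), rotated])
      (use assms(2,3) linear_eq_sum_Basis linear_frechet_derivative in \<open>metis image_subset_iff\<close>)
qed

text \<open>The induction varies the outer map only: the directional derivatives of
  \<open>g\<close>, composed with the unchanged \<open>f\<close>, fall under the induction
  hypothesis, and the derivative of \<open>f\<close> enters as a moving direction.\<close>

lemma Ck_on_compose:
  assumes "open U" "Ck_on k U f" "Ck_on k V g" "f ` U \<subseteq> V"
  shows "Ck_on k U (\<lambda>x. g (f x))"
  using assms(2,3)
proof (induction k arbitrary: g)
  case 0
  then show ?case using assms(4) by (auto intro: continuous_on_compose2)
next
  case (Suc k)
  have fd: "Ck_on k U (\<lambda>x. frechet_derivative g (at (f x)) b)" for b
    by (rule Suc.IH[OF Suc.prems(1)[THEN Ck_on_Suc_imp] Suc.prems(2)[THEN Ck_on_frechet_derivative]])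
  show ?case
  proof (rule Ck_on_SucI[OF assms(1)])
    show "((\<lambda>x. g (f x)) has_derivative
        (\<lambda>v. frechet_derivative g (at (f x)) (frechet_derivative f (at x) v))) (at x)"
      if "x \<in> U" for x
      using has_derivative_compose[OF Ck_on_has_derivative[OF Suc.prems(1) that]
          Ck_on_has_derivative[OF Suc.prems(2)]] assms(4) that by auto
    show "Ck_on k U (\<lambda>x. frechet_derivative g (at (f x)) (frechet_derivative f (at x) v))" for v
      by (rule Ck_on_frechet_derivative_apply[OF assms(1,4) _ fd])
        (use Suc.prems in auto)
  qed
qed

lemma Ck_on_inverse:
  fixes f :: "'d::euclidean_space \<Rightarrow> real"
  assumes "open U" "Ck_on k U f" "\<And>x. x \<in> U \<Longrightarrow> f x \<noteq> 0"
  shows "Ck_on k U (\<lambda>x. inverse (f x))"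
  using assms(2)
proof (induction k)
  case 0
  then show ?case using assms(3) by (auto intro: continuous_on_inverse)
next
  case (Suc k)
  note IH = Suc.IH[OF Ck_on_Suc_imp[OF Suc.prems]]
  show ?case
  proof (rule Ck_on_SucI[OF assms(1)])
    show "((\<lambda>x. inverse (f x)) has_derivative
        (\<lambda>v. - (inverse (f x) * frechet_derivative f (at x) v * inverse (f x)))) (at x)" if "x \<in> U" for x
      using Deriv.has_derivative_inverse[OF assms(3)[OF that] Ck_on_has_derivative[OF Suc.prems that]] .
  qed (intro Ck_on_minus Ck_on_mult IH Ck_on_frechet_derivative[OF Suc.prems] assms(1))
qed

lemma Ck_on_divide:
  fixes f g :: "'d::euclidean_space \<Rightarrow> real"
  assumes "open U" "Ck_on k U f" "Ck_on k U g" "\<And>x. x \<in> U \<Longrightarrow> g x \<noteq> 0"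
  shows "Ck_on k U (\<lambda>x. f x / g x)"
  unfolding divide_inverse by (intro Ck_on_mult Ck_on_inverse assms)

lemma Ck_on_det:
  fixes A :: "'d::euclidean_space \<Rightarrow> real ^ 'i ^ 'i"
  assumes "open U" "\<And>i j. Ck_on k U (\<lambda>x. A x $ i $ j)"
  shows "Ck_on k U (\<lambda>x. det (A x))"
  unfolding det_def by (intro Ck_on_sum Ck_on_mult Ck_on_const Ck_on_prod assms)

declare Ck_on.simps(2) [simp del]

section \<open>Smooth maps on arbitrary subsets, and derivatives along curves\<close>

lemma smooth_onE:
  assumes "smooth_on M f" "x \<in> M"
  obtains U h where "open U" "x \<in> U" "\<And>k. Ck_on k U h" "\<And>y. y \<in> M \<Longrightarrow> y \<in> U \<Longrightarrow> h y = f y"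
proof -
  have "\<exists>U h. open U \<and> x \<in> U \<and> (\<forall>k. Ck_on k U h) \<and> (\<forall>y\<in>M \<inter> U. h y = f y)"
    using assms(1)[unfolded smooth_on_def, THEN bspec, OF assms(2)] .
  then obtain U h where "open U \<and> x \<in> U \<and> (\<forall>k. Ck_on k U h) \<and> (\<forall>y\<in>M \<inter> U. h y = f y)"
    by (elim exE)
  then show ?thesis using that[of U h] by blast
qed

lemma smooth_on_imp_Ck_on:
  assumes "open M" "smooth_on M f"
  shows "Ck_on k M f"
proof (rule Ck_on_local)
  fix x assume "x \<in> M"
  obtain U h where h: "open U" "x \<in> U" "\<And>k. Ck_on k U h" "\<And>y. y \<in> M \<Longrightarrow> y \<in> U \<Longrightarrow> h y = f y"
    using smooth_onE[OF assms(2) \<open>x \<in> M\<close>] by metis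
  have "Ck_on k (M \<inter> U) f"
    by (rule Ck_on_cong[of _ h]) (use h assms(1) in \<open>auto intro: Ck_on_subset\<close>)
  then show "\<exists>V. open V \<and> x \<in> V \<and> Ck_on k V f"
    using \<open>x \<in> M\<close> h assms(1) by (intro exI[of _ "M \<inter> U"]) auto
qed

lemma smooth_on_subset_open:
  assumes "open U" "\<And>k. Ck_on k U f" "M \<subseteq> U"
  shows "smooth_on M f"
  unfolding smooth_on_def using assms by (intro ballI exI[of _ U] exI[of _ f]) auto

lemma eventually_nhds_curve:
  assumes "(y has_vector_derivative v) (at (0::real))" "open U" "y 0 \<in> U"
  shows "\<forall>\<^sub>F t in nhds 0. y t \<in> U"
proof -
  have "isCont y 0" using assms(1) has_vector_derivative_continuous by blast
  then show ?thesis
    using topological_tendstoD[OF _ assms(2,3)] by (simp add: isCont_def tendsto_at_iff_tendsto_nhds)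
qed

lemma has_vector_derivative_transform_nhds:
  assumes "(f has_vector_derivative d) (at (0::real))" "\<forall>\<^sub>F t in nhds 0. f t = g t"
  shows "(g has_vector_derivative d) (at 0)"
  using has_vector_derivative_cong_ev[where S = UNIV and x = 0 and f = f and g = g] assms
    eventually_nhds_x_imp_x[OF assms(2)] by auto

lemma has_vector_derivative_compose:
  assumes "(y has_vector_derivative v) (at 0)" "(f has_derivative f') (at (y 0))"
  shows "((\<lambda>t. f (y t)) has_vector_derivative f' v) (at (0::real))"
  using has_derivative_compose[OF assms(1)[unfolded has_vector_derivative_def] assms(2)]
    linear_cmul[OF has_derivative_linear[OF assms(2)]]
  unfolding has_vector_derivative_def by simp

lemma smooth_on_differentiable_curve:
  assumes "smooth_on M f" "\<forall>\<^sub>F t in nhds (0::real). y t \<in> M"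
    "(y has_vector_derivative v) (at 0)"
  shows "\<exists>s. ((\<lambda>t. f (y t)) has_vector_derivative s) (at 0)"
proof -
  have "y 0 \<in> M" using assms(2) by (rule eventually_nhds_x_imp_x)
  then obtain U h where h: "open U" "y 0 \<in> U" "\<And>k. Ck_on k U h" "\<And>z. z \<in> M \<Longrightarrow> z \<in> U \<Longrightarrow> h z = f z"
    using smooth_onE[OF assms(1)] by metis
  have "\<forall>\<^sub>F t in nhds 0. y t \<in> U" by (rule eventually_nhds_curve[OF assms(3) h(1,2)])
  then have "\<forall>\<^sub>F t in nhds 0. h (y t) = f (y t)"
    using assms(2) by eventually_elim (use h(4) in auto)
  from has_vector_derivative_transform_nhds[OF
      has_vector_derivative_compose[OF assms(3) Ck_on_has_derivative[OF h(3,2)]] this]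
  show ?thesis by (rule exI)
qed

text \<open>Derivatives within a general set need not be unique as linear maps. Along a curve in
  \<open>M\<close> with velocity \<open>v\<close>, the chain rule turns each of them into the
  derivative of the same function of one variable, so their values on \<open>v\<close>
  coincide.\<close>

lemma differential_eq:
  assumes "(f has_derivative f') (at x within M)" "v \<in> tangent_space M x"
  shows "differential M f x v = f' v"
proof -
  obtain \<gamma> \<delta> where \<gamma>: "0 < \<delta>" "\<gamma> ` {-\<delta><..<\<delta>} \<subseteq> M" "\<gamma> (0::real) = x"
      "(\<gamma> has_vector_derivative v) (at 0)"
    using assms(2) unfolding tangent_space_def by blast
  have *: "((\<lambda>t. f (\<gamma> t)) has_vector_derivative g v) (at 0)"
    if g: "(f has_derivative g) (at x within M)" for g
  proof -
    have "(\<gamma> has_derivative (\<lambda>t. t *\<^sub>R v)) (at 0 within {-\<delta><..<\<delta>})"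
      using \<gamma>(4) unfolding has_vector_derivative_def by (rule has_derivative_at_withinI)
    moreover have "(f has_derivative g) (at (\<gamma> 0) within \<gamma> ` {-\<delta><..<\<delta>})"
      using has_derivative_subset[OF g \<gamma>(2)] \<gamma>(3) by simp
    ultimately have "((\<lambda>t. f (\<gamma> t)) has_derivative (\<lambda>t. g (t *\<^sub>R v))) (at 0 within {-\<delta><..<\<delta>})"
      by (rule has_derivative_in_compose)
    moreover have "(at 0 within {-\<delta><..<\<delta>}) = (at (0::real))"
      using \<gamma>(1) by (intro at_within_open) auto
    ultimately show ?thesis
      unfolding has_vector_derivative_def
      using linear_cmul[OF has_derivative_linear[OF g]] by simp
  qed
  have "(f has_derivative differential M f x) (at x within M)"
    unfolding differential_def using assms(1) frechet_derivative_works differentiable_def by blast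
  from *[OF this] *[OF assms(1)] show ?thesis by (rule vector_derivative_unique_at)
qed

text \<open>In the product rule the derivative of \<open>T\<close> is multiplied by
  \<open>L 0 = 0\<close>, and \<open>T 0\<close> is the identity on \<open>G\<close>. This removes
  the trivialization of a target bundle from the computation of an intrinsic derivative.\<close>

lemma has_vector_derivative_linear_family:
  assumes T: "\<forall>\<^sub>F t in nhds 0. linear (T t)" "\<And>c. c \<in> G \<Longrightarrow> T 0 c = c"
    "\<And>c. c \<in> G \<Longrightarrow> \<exists>s. ((\<lambda>t. T t c) has_vector_derivative s) (at 0)"
    and G: "subspace G"
    and L: "\<forall>\<^sub>F t in nhds (0::real). L t \<in> G" "(L has_vector_derivative d) (at 0)" "L 0 = 0"
  shows "((\<lambda>t. T t (L t :: 'a::euclidean_space) :: 'a) has_vector_derivative d) (at 0)"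
proof -
  \<comment> \<open>The family is controlled only on \<open>G\<close>, so vectors are expanded in a
    basis of \<open>G\<close> rather than of the whole space.\<close>
  obtain B where B: "B \<subseteq> G" "pairwise orthogonal B" "\<And>x. x \<in> B \<Longrightarrow> norm x = 1"
      "independent B" "span B = G"
    using orthonormal_basis_subspace[OF G] by metis
  have fin: "finite B" using B(4) independent_imp_finite by blast
  have ex: "(\<Sum>b\<in>B. (z \<bullet> b) *\<^sub>R b) = z" if "z \<in> G" for z
    using orthonormal_basis_expand[OF B(2,3) _ fin] B(5) that by blast
  obtain s where s: "\<And>b. b \<in> B \<Longrightarrow> ((\<lambda>t. T t b) has_vector_derivative s b) (at 0)"
    using T(3) B(1) by (metis subsetD)
  have Lb: "((\<lambda>t. L t \<bullet> b) has_field_derivative d \<bullet> b) (at 0)" for b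
    using bounded_linear.has_vector_derivative[OF bounded_linear_inner_left L(2)]
    by (simp add: has_real_derivative_iff_has_vector_derivative)
  have "((\<lambda>t. \<Sum>b\<in>B. (L t \<bullet> b) *\<^sub>R b) has_vector_derivative (\<Sum>b\<in>B. (d \<bullet> b) *\<^sub>R b)) (at 0)"
    using has_vector_derivative_sum[of B "\<lambda>b t. (L t \<bullet> b) *\<^sub>R b" "\<lambda>b. (d \<bullet> b) *\<^sub>R b" "at 0"]
      has_vector_derivative_scaleR[OF Lb has_vector_derivative_const] by auto
  moreover have "\<forall>\<^sub>F t in nhds 0. (\<Sum>b\<in>B. (L t \<bullet> b) *\<^sub>R b) = L t"
    using L(1) by eventually_elim (rule ex)
  ultimately have "(L has_vector_derivative (\<Sum>b\<in>B. (d \<bullet> b) *\<^sub>R b)) (at 0)"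
    by (rule has_vector_derivative_transform_nhds)
  \<comment> \<open>The derivative of a curve in \<open>G\<close> stays in \<open>G\<close>: it
    equals the derivative of the expansion of the curve.\<close>
  then have d: "(\<Sum>b\<in>B. (d \<bullet> b) *\<^sub>R b) = d"
    using L(2) vector_derivative_unique_at by blast
  have "((\<lambda>t. \<Sum>b\<in>B. (L t \<bullet> b) *\<^sub>R T t b) has_vector_derivative
      (\<Sum>b\<in>B. (L 0 \<bullet> b) *\<^sub>R s b + (d \<bullet> b) *\<^sub>R T 0 b)) (at 0)"
    by (rule has_vector_derivative_sum) (rule has_vector_derivative_scaleR[OF Lb s])
  moreover have "(\<Sum>b\<in>B. (L 0 \<bullet> b) *\<^sub>R s b + (d \<bullet> b) *\<^sub>R T 0 b) = d"
    using B(1) T(2) L(3) d by (simp add: subset_iff)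
  moreover have "\<forall>\<^sub>F t in nhds 0. (\<Sum>b\<in>B. (L t \<bullet> b) *\<^sub>R T t b) = T t (L t)"
    using L(1) T(1)
  proof eventually_elim
    case (elim t)
    have "T t (L t) = T t (\<Sum>b\<in>B. (L t \<bullet> b) *\<^sub>R b)" by (simp add: ex[OF elim(1)])
    also have "\<dots> = (\<Sum>b\<in>B. (L t \<bullet> b) *\<^sub>R T t b)"
      by (simp only: linear_sum[OF elim(2)] linear_cmul[OF elim(2)] o_def)
    finally show ?case by simp
  qed
  ultimately show ?thesis
    using has_vector_derivative_transform_nhds[of "\<lambda>t. \<Sum>b\<in>B. (L t \<bullet> b) *\<^sub>R T t b" d] by simp
qed

text \<open>Product rule for a derivative applied to a moving vector: one term is the second
  derivative, the other comes from the motion of the vector. Basis expansions are used because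
  \<open>Ck_on\<close> speaks of fixed directions.\<close>

lemma has_vector_derivative_frechet_apply:
  fixes f :: "'a::euclidean_space \<Rightarrow> 'b::euclidean_space"
  assumes "open D" "Ck_on (Suc (Suc 0)) D f" "y 0 \<in> D"
    and y: "(y has_vector_derivative v) (at (0::real))" and b: "(b has_vector_derivative s) (at 0)"
  shows "((\<lambda>t. frechet_derivative f (at (y t)) (b t)) has_vector_derivative
     frechet_derivative (\<lambda>z. frechet_derivative f (at z) (b 0)) (at (y 0)) v
       + frechet_derivative f (at (y 0)) s) (at 0)"
proof -
  let ?D = "\<lambda>z. frechet_derivative f (at z)"
  let ?DD = "\<lambda>i. frechet_derivative (\<lambda>z. ?D z i) (at (y 0))"
  have lin: "linear (?D z)" if "z \<in> D" for z
    using has_derivative_linear[OF Ck_on_has_derivative[OF assms(2) that]] .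
  have d: "((\<lambda>z. ?D z i) has_derivative ?DD i) (at (y 0))" for i
    by (rule Ck_on_has_derivative[OF Ck_on_frechet_derivative[OF assms(2)] assms(3)])
  have bi: "((\<lambda>t. b t \<bullet> i) has_field_derivative s \<bullet> i) (at 0)" for i
    using bounded_linear.has_vector_derivative[OF bounded_linear_inner_left b]
    by (simp add: has_real_derivative_iff_has_vector_derivative)
  have 1: "((\<lambda>t. \<Sum>i\<in>Basis. (b t \<bullet> i) *\<^sub>R ?D (y t) i) has_vector_derivative
      (\<Sum>i\<in>Basis. (b 0 \<bullet> i) *\<^sub>R ?DD i v + (s \<bullet> i) *\<^sub>R ?D (y 0) i)) (at 0)"
    by (rule has_vector_derivative_sum)
      (rule has_vector_derivative_scaleR[OF bi has_vector_derivative_compose[OF y d]])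
  have ev: "\<forall>\<^sub>F t in nhds 0. y t \<in> D"
    by (rule eventually_nhds_curve[OF y assms(1,3)])
  have 2: "\<forall>\<^sub>F t in nhds 0. (\<Sum>i\<in>Basis. (b t \<bullet> i) *\<^sub>R ?D (y t) i) = ?D (y t) (b t)"
    using ev by eventually_elim (use linear_eq_sum_Basis[OF lin] in metis)
  have "((\<lambda>z. \<Sum>i\<in>Basis. (b 0 \<bullet> i) *\<^sub>R ?D z i) has_derivative
      (\<lambda>v. \<Sum>i\<in>Basis. (b 0 \<bullet> i) *\<^sub>R ?DD i v)) (at (y 0))"
    by (intro has_derivative_sum has_derivative_scaleR_right d)
  then have "((\<lambda>z. ?D z (b 0)) has_derivative (\<lambda>v. \<Sum>i\<in>Basis. (b 0 \<bullet> i) *\<^sub>R ?DD i v)) (at (y 0))"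
    by (rule has_derivative_transform_within_open[OF _ assms(1,3)])
      (use linear_eq_sum_Basis[OF lin] in metis)
  from fun_cong[OF frechet_derivative_at[OF this], of v]
  have "?DD (b 0) v = (\<Sum>i\<in>Basis. (b 0 \<bullet> i) *\<^sub>R ?DD i v)" by simp
  then have "?DD (b 0) v + ?D (y 0) s = (\<Sum>i\<in>Basis. (b 0 \<bullet> i) *\<^sub>R ?DD i v + (s \<bullet> i) *\<^sub>R ?D (y 0) i)"
    using linear_eq_sum_Basis[OF lin[OF assms(3)], of s] by (simp add: sum.distrib)
  then show ?thesis using has_vector_derivative_transform_nhds[OF 1 2] by simp
qed

section \<open>Smooth neighbourhood retracts\<close>

locale smooth_retract =
  fixes W M :: "'a::euclidean_space set" and r :: "'a \<Rightarrow> 'a"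
  assumes open_W: "open W" and M_subset: "M \<subseteq> W" and Ck: "\<And>k. Ck_on k W r"
    and r_into: "\<And>x. x \<in> W \<Longrightarrow> r x \<in> M" and r_id: "\<And>x. x \<in> M \<Longrightarrow> r x = x"
begin

abbreviation P :: "'a \<Rightarrow> 'a \<Rightarrow> 'a" where "P y \<equiv> frechet_derivative r (at y)"

lemma in_W: "x \<in> M \<Longrightarrow> x \<in> W" using M_subset by auto

lemma P: "x \<in> W \<Longrightarrow> (r has_derivative P x) (at x)"
  by (rule Ck_on_has_derivative[OF Ck])

lemma linear_P: "x \<in> W \<Longrightarrow> linear (P x)"
  using P has_derivative_linear by blast

lemma P_idem:
  assumes "x \<in> M" shows "P x (P x v) = P x v"
proof -
  have "((\<lambda>y. r (r y)) has_derivative (\<lambda>v. P x (P x v))) (at x)"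
    using has_derivative_compose[OF P[OF in_W[OF assms]], of r "P x"] P[OF in_W[OF assms]]
    by (simp add: r_id assms)
  moreover have "((\<lambda>y. r (r y)) has_derivative P x) (at x)"
    by (rule has_derivative_transform_within_open[OF P open_W]) (use assms in \<open>auto simp: in_W r_id r_into\<close>)
  ultimately have "(\<lambda>v. P x (P x v)) = P x" by (rule has_derivative_unique)
  then show ?thesis by metis
qed

lemma P_curve:
  assumes "\<forall>\<^sub>F t in nhds (0::real). y t \<in> M" "(y has_vector_derivative v) (at 0)"
  shows "P (y 0) v = v"
proof -
  have "y 0 \<in> M" using assms(1) by (rule eventually_nhds_x_imp_x)
  from has_vector_derivative_compose[OF assms(2) P[OF in_W[OF this]]]
  have "(y has_vector_derivative P (y 0) v) (at 0)"
    by (rule has_vector_derivative_transform_nhds) (use assms(1) in \<open>eventually_elim, simp add: r_id\<close>)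
  then show ?thesis using assms(2) vector_derivative_unique_at by blast
qed

lemma exp_curve:
  assumes "x \<in> M" "P x v = v"
  shows "\<exists>\<delta>>0. \<forall>w. norm w < \<delta> \<longrightarrow> x + w \<in> W" "((\<lambda>w. r (x + w)) has_derivative P x) (at 0)"
    "((\<lambda>t::real. r (x + t *\<^sub>R v)) has_vector_derivative v) (at 0)"
proof -
  obtain e where e: "e > 0" "ball x e \<subseteq> W"
    using open_W in_W[OF assms(1)] open_contains_ball by blast
  have "x + w \<in> W" if "norm w < e" for w
    using e(2) that by (auto simp: subset_iff dist_norm)
  then show "\<exists>\<delta>>0. \<forall>w. norm w < \<delta> \<longrightarrow> x + w \<in> W" using e(1) by blast
  have "((\<lambda>w. x + w) has_derivative (\<lambda>w. w)) (at 0)"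
    by (auto intro!: derivative_eq_intros)
  from has_derivative_compose[OF this, of r "P x"] P[OF in_W[OF assms(1)]]
  show 1: "((\<lambda>w. r (x + w)) has_derivative P x) (at 0)" by simp
  have "((\<lambda>t::real. t *\<^sub>R v) has_vector_derivative v) (at 0)"
    by (auto intro!: derivative_eq_intros)
  from has_vector_derivative_compose[OF this, of "\<lambda>w. r (x + w)" "P x"] 1
  show "((\<lambda>t::real. r (x + t *\<^sub>R v)) has_vector_derivative v) (at 0)"
    by (simp add: assms(2))
qed

lemma Ck_exp: "open U \<Longrightarrow> (\<And>w. w \<in> U \<Longrightarrow> x + h w \<in> W) \<Longrightarrow> linear h \<Longrightarrow> Ck_on k U (\<lambda>w. r (x + h w))"
  by (rule Ck_on_compose[OF _ _ Ck]) (auto intro: Ck_on_add[OF _ Ck_on_const Ck_on_linear])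

text \<open>A curve in \<open>M\<close> is fixed by \<open>r\<close>, hence its velocity is fixed by
  \<open>P x\<close>; conversely a fixed vector is the velocity of the retracted line through
  \<open>x\<close>.\<close>

lemma tangent_space_eq:
  assumes "x \<in> M"
  shows "tangent_space M x = {v. P x v = v}"
proof (intro equalityI subsetI CollectI)
  fix v assume "v \<in> tangent_space M x"
  then obtain \<gamma> \<delta> where \<gamma>: "0 < \<delta>" "\<gamma> ` {-\<delta><..<\<delta>} \<subseteq> M" "\<gamma> (0::real) = x"
      "(\<gamma> has_vector_derivative v) (at 0)"
    unfolding tangent_space_def by blast
  have "\<forall>\<^sub>F t in nhds 0. t \<in> {-\<delta><..<\<delta>}"
    using \<gamma>(1) by (intro eventually_nhds_in_open) auto
  then have "\<forall>\<^sub>F t in nhds 0. \<gamma> t \<in> M" by eventually_elim (use \<gamma>(2) in blast)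
  from P_curve[OF this \<gamma>(4)] show "P x v = v" by (simp add: \<gamma>(3))
next
  fix v assume "v \<in> {v. P x v = v}"
  then have v: "P x v = v" by simp
  obtain d where d: "d > 0" "\<And>w. norm w < d \<Longrightarrow> x + w \<in> W"
    using exp_curve(1)[OF assms v] by blast
  \<comment> \<open>Adding 1 avoids division by zero for \<open>v = 0\<close>; times of modulus
    below this bound keep the line inside \<open>W\<close>.\<close>
  define \<delta> where "\<delta> = d / (norm v + 1)"
  have \<delta>: "\<delta> > 0" using d(1) by (auto simp: \<delta>_def add_nonneg_pos)
  have in_W': "x + t *\<^sub>R v \<in> W" if "t \<in> {-\<delta><..<\<delta>}" for t
  proof (rule d(2))
    have "\<bar>t\<bar> < \<delta>" using that by auto
    then have "\<bar>t\<bar> * (norm v + 1) < d"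
      unfolding \<delta>_def by (simp add: pos_less_divide_eq add_nonneg_pos)
    then show "norm (t *\<^sub>R v) < d" by (simp add: algebra_simps)
  qed
  show "v \<in> tangent_space M x"
    unfolding tangent_space_def
  proof (intro CollectI exI conjI)
    show "smooth_on {-\<delta><..<\<delta>} (\<lambda>t. r (x + t *\<^sub>R v))"
      by (rule smooth_on_subset_open[of "{-\<delta><..<\<delta>}", OF _ Ck_exp])
        (use in_W' in \<open>auto intro!: linearI simp: scaleR_add_left\<close>)
    show "(\<lambda>t. r (x + t *\<^sub>R v)) ` {-\<delta><..<\<delta>} \<subseteq> M" using in_W' r_into by auto
    show "((\<lambda>t. r (x + t *\<^sub>R v)) has_vector_derivative v) (at 0)" by (rule exp_curve[OF assms v])
  qed (use \<delta> assms r_id in auto)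
qed

lemma P_in_tangent_space: "x \<in> M \<Longrightarrow> P x v \<in> tangent_space M x"
  by (simp add: tangent_space_eq P_idem)

lemma subspace_tangent_space:
  assumes "x \<in> M" shows "subspace (tangent_space M x)"
proof -
  interpret linear "P x" using linear_P[OF in_W[OF assms]] .
  show ?thesis unfolding tangent_space_eq[OF assms] subspace_def by (simp add: zero add scale)
qed

text \<open>Projections close to each other are intertwined by an operator close to the identity,
  and an operator that moves each vector by at most half its length is injective, hence bijective in
  finite dimension.\<close>

lemma bij_betw_P:
  assumes "x \<in> M"
  shows "\<exists>U. open U \<and> x \<in> U \<and> U \<subseteq> W \<and>
     (\<forall>y\<in>M \<inter> U. bij_betw (P y) (tangent_space M x) (tangent_space M y))"
proof -
  have xW: "x \<in> W" by (rule in_W[OF assms])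
  interpret X: linear "P x" using linear_P[OF xW] .
  \<comment> \<open>The reflection \<open>2 P x - 1\<close> is bounded here because it is a factor
    of \<open>A - 1\<close> below; the threshold \<open>1 / (2 * K)\<close> then yields the factor
    one half.\<close>
  obtain K where K: "K > 0" "\<And>u. norm (2 *\<^sub>R P x u - u) \<le> K * norm u"
  proof -
    have "bounded_linear (\<lambda>u. 2 *\<^sub>R P x u - u)"
      using P[OF xW] has_derivative_bounded_linear
      by (intro bounded_linear_sub bounded_linear_ident bounded_linear_const_scaleR) blast
    from bounded_linear.pos_bounded[OF this] show ?thesis
      using that by (metis mult.commute)
  qed
  \<comment> \<open>A bound for the operator norm of \<open>P y - P x\<close> that is visibly
    continuous in \<open>y\<close>.\<close>
  define s where "s y = (\<Sum>i\<in>Basis. norm (P y i - P x i))" for y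
  have "continuous_on W s"
    unfolding s_def
    by (intro continuous_intros Ck_on_imp_continuous_on[OF Ck_on_frechet_derivative[OF Ck]])
  then have "open (W \<inter> s -` {..<1 / (2 * K)})"
    by (rule continuous_open_preimage[OF _ open_W]) auto
  moreover have "s x < 1 / (2 * K)" using K(1) by (simp add: s_def)
  moreover have "bij_betw (P y) (tangent_space M x) (tangent_space M y)"
    if y: "y \<in> M" and sy: "s y < 1 / (2 * K)" for y
  proof -
    interpret Y: linear "P y" using linear_P[OF in_W[OF y]] .
    have near: "norm (P y b - P x b) \<le> s y * norm b" for b
    proof -
      have "P y b - P x b = (\<Sum>i\<in>Basis. (b \<bullet> i) *\<^sub>R (P y i - P x i))"
        by (simp add: linear_eq_sum_Basis[OF Y.linear_axioms, of b]
            linear_eq_sum_Basis[OF X.linear_axioms, of b] scaleR_diff_right sum_subtractf)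
      also have "norm \<dots> \<le> (\<Sum>i\<in>Basis. norm b * norm (P y i - P x i))"
        by (rule sum_norm_le) (auto intro!: mult_right_mono Basis_le_norm)
      finally show ?thesis by (simp add: s_def sum_distrib_left sum_distrib_right mult.commute)
    qed
    \<comment> \<open>The intertwiner \<open>P y P x + (1 - P y) (1 - P x)\<close>. It satisfies
      \<open>P y A = P y P x\<close>, agrees with \<open>P y\<close> on the tangent space at
      \<open>x\<close>, and \<open>A - 1 = (P y - P x) (2 P x - 1)\<close>.\<close>
    define A where "A u = P y (P x u) + (u - P x u) - P y (u - P x u)" for u
    have linA: "linear A"
      unfolding A_def
      by (rule linearI) (simp_all add: X.add Y.add Y.diff X.scale Y.scale algebra_simps)
    have An: "norm (A u - u) \<le> norm u / 2" for u
    proof -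
      have "A u - u = P y (2 *\<^sub>R P x u - u) - P x (2 *\<^sub>R P x u - u)"
        unfolding A_def by (simp add: X.diff Y.diff X.scale Y.scale P_idem[OF assms] scaleR_2 X.add Y.add)
      then have "norm (A u - u) \<le> s y * norm (2 *\<^sub>R P x u - u)" using near by simp
      also have "\<dots> \<le> 1 / (2 * K) * (K * norm u)"
        by (rule mult_mono) (use sy K in auto)
      finally show ?thesis using K(1) by simp
    qed
    have "inj A"
      unfolding linear_injective_0[OF linA]
    proof (intro allI impI)
      fix u assume "A u = 0"
      with An[of u] show "u = 0" by simp
    qed
    then have surjA: "surj A" using linear_injective_imp_surjective[OF linA] by blast
    have PA: "P y (A u) = P y (P x u)" for u
      unfolding A_def by (simp add: Y.add Y.diff P_idem[OF y])
    have PT: "P y a = A a" if "a \<in> tangent_space M x" for a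
      using that by (simp add: tangent_space_eq[OF assms] A_def Y.zero)
    show ?thesis
      unfolding bij_betw_def
    proof (intro conjI equalityI subsetI)
      show "inj_on (P y) (tangent_space M x)"
        using PT \<open>inj A\<close> by (metis inj_onI injD)
      show "w \<in> tangent_space M y" if "w \<in> P y ` tangent_space M x" for w
        using that P_in_tangent_space[OF y] by auto
      fix w assume w: "w \<in> tangent_space M y"
      obtain u where "w = A u" using surjA by blast
      then have "w = P y (P x u)" using w PA by (simp add: tangent_space_eq[OF y])
      then show "w \<in> P y ` tangent_space M x" using P_in_tangent_space[OF assms] by blast
    qed
  qed
  ultimately show ?thesis using xW by (intro exI[of _ "W \<inter> s -` {..<1 / (2 * K)}"]) auto
qed

lemma local_trivialization_P:
  assumes "x \<in> M" shows "local_trivialization M (tangent_space M) x P"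
proof -
  obtain U where U: "open U" "x \<in> U" "U \<subseteq> W"
      "\<And>y. y \<in> M \<inter> U \<Longrightarrow> bij_betw (P y) (tangent_space M x) (tangent_space M y)"
    using bij_betw_P[OF assms] by blast
  have "smooth_on (M \<inter> U) (\<lambda>y. P y a)" for a
    by (rule smooth_on_subset_open[OF open_W Ck_on_frechet_derivative[OF Ck]]) (use U in auto)
  then show ?thesis
    unfolding local_trivialization_def using U linear_P
    by (auto simp: tangent_space_eq[OF assms] intro!: exI[of _ U])
qed

text \<open>The derivative at \<open>0\<close> in the ambient space is \<open>P x\<close>; it agrees
  with the identity on tangent vectors, and a derivative within the tangent space sees no
  others.\<close>

lemma exponential_map_retraction:
  assumes "x \<in> M" shows "exponential_map M x (\<lambda>w. r (x + w))"
proof -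
  have 0: "P x 0 = 0" using linear_0[OF linear_P[OF in_W[OF assms]]] .
  obtain d where d: "d > 0" "\<And>w. norm w < d \<Longrightarrow> x + w \<in> W"
    using exp_curve(1)[OF assms 0] by blast
  have "smooth_on (tangent_space M x \<inter> ball 0 d) (\<lambda>w. r (x + w))"
    by (rule smooth_on_subset_open[of "ball 0 d"]) (auto intro!: Ck_exp d(2) linear_ident)
  moreover have "(\<lambda>w. r (x + w)) ` (tangent_space M x \<inter> ball 0 d) \<subseteq> M"
    using d(2) r_into by auto
  moreover have "((\<lambda>w. r (x + w)) has_derivative (\<lambda>w. w)) (at 0 within tangent_space M x)"
  proof -
    have h: "((\<lambda>w. r (x + w)) has_derivative P x) (at 0 within tangent_space M x)"
      using exp_curve(2)[OF assms 0] by (rule has_derivative_at_withinI)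
    show ?thesis
      unfolding has_derivative_within
    proof (intro conjI bounded_linear_ident)
      have "\<forall>\<^sub>F w in at 0 within tangent_space M x. w \<in> tangent_space M x"
        by (rule eventually_at_topological[THEN iffD2]) auto
      then show "((\<lambda>y. (1 / norm (y - 0)) *\<^sub>R (r (x + y) - (r (x + 0) + (y - 0)))) \<longlongrightarrow> 0)
          (at 0 within tangent_space M x)"
        by (rule Lim_transform_eventually[OF h[unfolded has_derivative_within, THEN conjunct2] eventually_mono])
          (simp add: tangent_space_eq[OF assms])
    qed
  qed
  ultimately show ?thesis
    unfolding exponential_map_def using d(1) r_id[OF assms] by auto
qed

text \<open>Every admissible choice produces data of the same kind: a curve \<open>y\<close> in
  \<open>M\<close> with velocity \<open>v\<close> and a tangent field \<open>b\<close> along it with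
  \<open>b 0 = a\<close>. If these properties alone fix the coset, as \<open>key\<close> demands, it
  is the value of the definite description. The constant target fibre \<open>G\<close> is the
  situation of a map into an open set or a linear subspace.\<close>

lemma intrinsic_derivative_eqI:
  fixes \<psi> :: "'a \<Rightarrow> 'a \<Rightarrow> 'c::euclidean_space" and G C :: "'c set"
  assumes x: "x \<in> M" and v: "v \<in> tangent_space M x" and a: "a \<in> tangent_space M x"
    and G: "subspace G" and F': "\<And>y. y \<in> M \<Longrightarrow> F' y = G"
    and \<psi>: "\<And>y b. y \<in> M \<Longrightarrow> b \<in> tangent_space M y \<Longrightarrow> \<psi> y b \<in> G" and "\<psi> x a = 0"
    and key: "\<And>y b s. \<lbrakk>\<forall>\<^sub>F t in nhds (0::real). y t \<in> M; y 0 = x; (y has_vector_derivative v) (at 0);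
       \<forall>\<^sub>F t in nhds 0. b t \<in> tangent_space M (y t); b 0 = a; (b has_vector_derivative s) (at 0)\<rbrakk>
       \<Longrightarrow> \<exists>d. ((\<lambda>t. \<psi> (y t) (b t)) has_vector_derivative d) (at 0) \<and> d +o \<psi> x ` tangent_space M x = C"
  shows "intrinsic_derivative M (tangent_space M) F' \<psi> x v a = C"
proof -
  \<comment> \<open>The line spanned by \<open>v\<close> stays in the tangent space, so the
    derivative of the exponential map within that space suffices for the chain rule.\<close>
  have curve: "\<forall>\<^sub>F t in nhds (0::real). \<epsilon> (t *\<^sub>R v) \<in> M" "\<epsilon> (0 *\<^sub>R v) = x"
      "((\<lambda>t. \<epsilon> (t *\<^sub>R v)) has_vector_derivative v) (at 0)"
    if E: "exponential_map M x \<epsilon>" for \<epsilon>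
  proof -
    obtain \<rho> where \<rho>: "\<rho> > 0" "\<epsilon> ` (tangent_space M x \<inter> ball 0 \<rho>) \<subseteq> M"
      using E[unfolded exponential_map_def, THEN conjunct1] by auto
    have tv: "t *\<^sub>R v \<in> tangent_space M x" for t
      using subspace_tangent_space[OF x] v by (simp add: subspace_scale)
    have lin: "((\<lambda>t::real. t *\<^sub>R v) has_vector_derivative v) (at 0)"
      by (auto intro!: derivative_eq_intros)
    have "\<forall>\<^sub>F t in nhds 0. t *\<^sub>R v \<in> ball 0 \<rho>"
      by (rule eventually_nhds_curve[OF lin]) (use \<rho>(1) in auto)
    then show "\<forall>\<^sub>F t in nhds (0::real). \<epsilon> (t *\<^sub>R v) \<in> M"
      by eventually_elim (use \<rho>(2) tv in blast)
    show "\<epsilon> (0 *\<^sub>R v) = x" using that unfolding exponential_map_def by simp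
    have "((\<lambda>t::real. t *\<^sub>R v) has_derivative (\<lambda>t. t *\<^sub>R v)) (at 0)"
      using lin unfolding has_vector_derivative_def .
    moreover have "(\<epsilon> has_derivative (\<lambda>w. w)) (at (0 *\<^sub>R v) within range (\<lambda>t::real. t *\<^sub>R v))"
      using that tv unfolding exponential_map_def by (auto intro: has_derivative_subset)
    ultimately show "((\<lambda>t. \<epsilon> (t *\<^sub>R v)) has_vector_derivative v) (at 0)"
      unfolding has_vector_derivative_def by (rule has_derivative_in_compose)
  qed
  have ev: "\<forall>\<^sub>F t in nhds (0::real). y t \<in> M \<and> linear (\<tau> (y t)) \<and> bij_betw (\<tau> (y t)) (F x) (F (y t))"
      "\<And>c. c \<in> F x \<Longrightarrow> \<tau> x c = c"
      "\<And>c. c \<in> F x \<Longrightarrow> \<exists>s. ((\<lambda>t. \<tau> (y t) c) has_vector_derivative s) (at 0)"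
    if \<tau>: "local_trivialization M F x \<tau>" and y: "\<forall>\<^sub>F t in nhds (0::real). y t \<in> M" "y 0 = x"
      "(y has_vector_derivative v) (at 0)"
    for F :: "'a \<Rightarrow> 'd::euclidean_space set" and \<tau> y
  proof -
    obtain U where U: "open U" "x \<in> U" "\<And>z. z \<in> M \<inter> U \<Longrightarrow> linear (\<tau> z) \<and> bij_betw (\<tau> z) (F x) (F z)"
        "\<And>c. c \<in> F x \<Longrightarrow> smooth_on (M \<inter> U) (\<lambda>z. \<tau> z c)"
      using \<tau> unfolding local_trivialization_def by blast
    have "\<forall>\<^sub>F t in nhds 0. y t \<in> U"
      by (rule eventually_nhds_curve[OF y(3) U(1)]) (simp add: y(2) U(2))
    then have MU: "\<forall>\<^sub>F t in nhds 0. y t \<in> M \<inter> U"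
      using y(1) by eventually_elim simp
    then show "\<forall>\<^sub>F t in nhds 0. y t \<in> M \<and> linear (\<tau> (y t)) \<and> bij_betw (\<tau> (y t)) (F x) (F (y t))"
      by eventually_elim (use U(3) in blast)
    show "\<tau> x c = c" if "c \<in> F x" for c
      using \<tau> that unfolding local_trivialization_def by blast
    show "\<exists>s. ((\<lambda>t. \<tau> (y t) c) has_vector_derivative s) (at 0)" if "c \<in> F x" for c
      using smooth_on_differentiable_curve[OF U(4)[OF that] MU y(3)] .
  qed
  have derivative_C: "d +o \<psi> x ` tangent_space M x = C"
    if "local_trivialization M (tangent_space M) x \<tau>" "local_trivialization M F' x \<tau>'"
      "exponential_map M x \<epsilon>"
      "((\<lambda>t. in_trivializations F' x \<tau> \<tau>' \<psi> (\<epsilon> (t *\<^sub>R v)) a) has_vector_derivative d) (at (0::real))"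
    for \<tau> \<tau>' \<epsilon> d
  proof -
    define y where "y t = \<epsilon> (t *\<^sub>R v)" for t
    note y = curve[OF that(3), folded y_def]
    note T = ev[OF that(1) y] and T' = ev[OF that(2) y]
    obtain s where s: "((\<lambda>t. \<tau> (y t) a) has_vector_derivative s) (at 0)" using T(3) a by blast
    have bT: "\<forall>\<^sub>F t in nhds 0. \<tau> (y t) a \<in> tangent_space M (y t)"
      using T(1) by eventually_elim (use a bij_betwE in blast)
    obtain d' where d': "((\<lambda>t. \<psi> (y t) (\<tau> (y t) a)) has_vector_derivative d') (at 0)"
        "d' +o \<psi> x ` tangent_space M x = C"
      using key[OF y bT _ s] T(2)[OF a] y(2) by auto
    define L where "L t = in_trivializations F' x \<tau> \<tau>' \<psi> (y t) a" for t
    have LG: "\<forall>\<^sub>F t in nhds 0. L t \<in> G \<and> \<tau>' (y t) (L t) = \<psi> (y t) (\<tau> (y t) a)"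
      using bT T'(1)
    proof eventually_elim
      case (elim t)
      have "\<psi> (y t) (\<tau> (y t) a) \<in> \<tau>' (y t) ` F' x"
        using elim \<psi> F' bij_betw_imp_surj_on by metis
      then show ?case
        unfolding L_def in_trivializations_def using F'[OF x]
        by (metis f_inv_into_f inv_into_into)
    qed
    \<comment> \<open>At \<open>t = 0\<close> both trivializations are the identity, so
      \<open>L 0\<close> is \<open>\<psi> x a\<close>, which vanishes because \<open>a\<close> lies
      in the kernel.\<close>
    have "L 0 = 0"
      using eventually_nhds_x_imp_x[OF LG] T'(2) F'[OF x] y(2) T(2)[OF a] assms(7) by auto
    moreover have "\<forall>\<^sub>F t in nhds 0. linear (\<tau>' (y t))" "\<forall>\<^sub>F t in nhds 0. L t \<in> G"
      using T'(1) LG by (auto elim: eventually_mono)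
    moreover have "\<tau>' (y 0) c = c" "\<exists>s. ((\<lambda>t. \<tau>' (y t) c) has_vector_derivative s) (at 0)"
      if "c \<in> G" for c
      using T'(2,3) that F'[OF x] y(2) by auto
    moreover have "(L has_vector_derivative d) (at 0)" using that(4) unfolding L_def y_def .
    ultimately have "((\<lambda>t. \<tau>' (y t) (L t)) has_vector_derivative d) (at 0)"
      using G has_vector_derivative_linear_family[where G = G and T = "\<lambda>t. \<tau>' (y t)" and L = L]
      by blast
    then have "((\<lambda>t. \<psi> (y t) (\<tau> (y t) a)) has_vector_derivative d) (at 0)"
      by (rule has_vector_derivative_transform_nhds) (use LG in \<open>eventually_elim, simp\<close>)
    then have "d = d'" using d'(1) vector_derivative_unique_at by blast
    then show ?thesis using d'(2) by simp
  qed
  \<comment> \<open>From here on one admissible choice is produced, so that the definite description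
    has a referent: the identity for the constant target bundle, the projections \<open>P\<close>
    for the tangent bundle.\<close>
  have triv: "local_trivialization M F' x (\<lambda>y c. c)"
    unfolding local_trivialization_def using F' x
    by (auto intro!: exI[of _ UNIV] linear_ident bij_betw_id smooth_on_subset_open[of UNIV] Ck_on_const
        simp: bij_betw_id[unfolded id_def])
  define \<epsilon> where "\<epsilon> w = r (x + w)" for w
  define y where "y t = \<epsilon> (t *\<^sub>R v)" for t
  have \<epsilon>: "exponential_map M x \<epsilon>" unfolding \<epsilon>_def by (rule exponential_map_retraction[OF x])
  note y = curve[OF \<epsilon>, folded y_def]
  note T = ev[OF local_trivialization_P[OF x] y]
  obtain s where s: "((\<lambda>t. P (y t) a) has_vector_derivative s) (at 0)" using T(3) a by blast
  have bT: "\<forall>\<^sub>F t in nhds 0. P (y t) a \<in> tangent_space M (y t)"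
    using T(1) by eventually_elim (use a bij_betwE in blast)
  obtain d where d: "((\<lambda>t. \<psi> (y t) (P (y t) a)) has_vector_derivative d) (at 0)"
      "d +o \<psi> x ` tangent_space M x = C"
    using key[OF y bT _ s] T(2)[OF a] y(2) by auto
  have "\<forall>\<^sub>F t in nhds 0. \<psi> (y t) (P (y t) a) = in_trivializations F' x P (\<lambda>y c. c) \<psi> (y t) a"
    using bT y(1)
  proof eventually_elim
    case (elim t)
    then have "\<psi> (y t) (P (y t) a) \<in> F' x" using \<psi> F' x by blast
    then show ?case unfolding in_trivializations_def using inv_into_f_f[of "\<lambda>c. c" "F' x"] by simp
  qed
  from has_vector_derivative_transform_nhds[OF d(1) this]
  have "((\<lambda>t. in_trivializations F' x P (\<lambda>y c. c) \<psi> (\<epsilon> (t *\<^sub>R v)) a) has_vector_derivative d) (at 0)"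
    by (simp add: y_def)
  then show ?thesis
    unfolding intrinsic_derivative_def
    using derivative_C local_trivialization_P[OF x] triv \<epsilon> d(2)
    by (intro the_equality) blast+
qed

end

section \<open>Quotient spaces\<close>

lemma coset_eq_iff:
  assumes "subspace K"
  shows "w +o K = w' +o K \<longleftrightarrow> w - w' \<in> K"
proof
  assume "w +o K = w' +o K"
  then have "w \<in> w' +o K" using subspace_0[OF assms] by (force simp: elt_set_plus_def)
  then show "w - w' \<in> K" by (auto simp: elt_set_plus_def)
next
  have sub: "a +o K \<subseteq> b +o K" if "a - b \<in> K" for a b
    using subspace_add[OF assms that] by (force simp: elt_set_plus_def algebra_simps)
  assume "w - w' \<in> K"
  moreover have "w' - w \<in> K" using subspace_neg[OF assms \<open>w - w' \<in> K\<close>] by simp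
  ultimately show "w +o K = w' +o K" using sub by blast
qed

lemma coset_add: "subspace K \<Longrightarrow> (w +o K) + (w' +o K) = (w + w') +o K"
proof (intro equalityI subsetI)
  fix z assume K: "subspace K" and "z \<in> (w +o K) + (w' +o K)"
  then obtain k k' where "k \<in> K" "k' \<in> K" "z = (w + k) + (w' + k')"
    by (auto simp: elt_set_plus_def set_plus_def)
  then show "z \<in> (w + w') +o K"
    using subspace_add[OF K] by (auto simp: elt_set_plus_def algebra_simps)
next
  fix z assume K: "subspace K" and "z \<in> (w + w') +o K"
  then obtain k where "k \<in> K" "z = (w + k) + (w' + 0)"
    by (auto simp: elt_set_plus_def algebra_simps)
  then show "z \<in> (w +o K) + (w' +o K)"
    using subspace_0[OF K] unfolding elt_set_plus_def set_plus_def by blast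
qed

lemma image_coset_add:
  assumes T: "linear T" and "subspace K" "subspace K'" "T ` K \<subseteq> K'"
  shows "T ` (w +o K) + K' = T w +o K'"
proof (intro equalityI subsetI)
  fix z assume "z \<in> T ` (w +o K) + K'"
  then obtain k k' where "k \<in> K" "k' \<in> K'" "z = T w + (T k + k')"
    by (auto simp: elt_set_plus_def set_plus_def linear_add[OF T] add.assoc)
  then show "z \<in> T w +o K'"
    using subspace_add[OF assms(3)] assms(4) by (auto simp: elt_set_plus_def)
next
  fix z assume "z \<in> T w +o K'"
  then obtain k where "k \<in> K'" "z = T (w + 0) + k" by (auto simp: elt_set_plus_def)
  then show "z \<in> T ` (w +o K) + K'"
    using subspace_0[OF assms(2)] unfolding elt_set_plus_def set_plus_def by blast
qed

lemma induced_map_coset: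
  assumes "linear T" "subspace K" "subspace K'" "T ` K \<subseteq> K'"
  shows "induced_map K' T (w +o K) = T w +o K'"
  unfolding induced_map_def by (rule image_coset_add[OF assms])

lemma scale_coset_coset:
  assumes "subspace K"
  shows "scale_coset K r (w +o K) = (r *\<^sub>R w) +o K"
  unfolding scale_coset_def
  by (rule image_coset_add[OF _ assms assms])
    (use subspace_scale[OF assms] in \<open>auto intro!: linearI simp: algebra_simps\<close>)

text \<open>By \<open>inj\<close>, the subspace \<open>K\<close> is exactly the part of
  \<open>W\<close> that \<open>T\<close> sends into \<open>K'\<close>: one direction makes the map
  well defined on cosets, the other makes it injective.\<close>

lemma quotient_iso_induced_map:
  assumes K: "subspace K" "subspace K'" and W: "subspace W" and T: "linear T" and sub: "K \<subseteq> W"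
    and TW: "\<And>w. w \<in> W \<Longrightarrow> T w \<in> W'" and inj: "\<And>w. w \<in> W \<Longrightarrow> T w \<in> K' \<longleftrightarrow> w \<in> K"
    and surj: "\<And>w'. w' \<in> W' \<Longrightarrow> \<exists>w\<in>W. w' - T w \<in> K'"
  shows "quotient_iso K ((\<lambda>w. w +o K) ` W) K' ((\<lambda>w. w +o K') ` W') (induced_map K' T)"
proof -
  have TK: "T ` K \<subseteq> K'" using inj sub by blast
  note im = induced_map_coset[OF T K TK]
  have "bij_betw (induced_map K' T) ((\<lambda>w. w +o K) ` W) ((\<lambda>w. w +o K') ` W')"
    unfolding bij_betw_def
  proof (intro conjI inj_onI)
    fix C D assume "C \<in> (\<lambda>w. w +o K) ` W" "D \<in> (\<lambda>w. w +o K) ` W"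
      and e: "induced_map K' T C = induced_map K' T D"
    then obtain w z where w: "w \<in> W" "C = w +o K" "z \<in> W" "D = z +o K" by blast
    with e have "T (w - z) \<in> K'" by (simp add: im coset_eq_iff[OF K(2)] linear_diff[OF T])
    then show "C = D" using inj[of "w - z"] w subspace_diff[OF W] coset_eq_iff[OF K(1)] by metis
  next
    show "induced_map K' T ` (\<lambda>w. w +o K) ` W = (\<lambda>w. w +o K') ` W'"
    proof (intro equalityI subsetI)
      fix D assume "D \<in> induced_map K' T ` (\<lambda>w. w +o K) ` W"
      then show "D \<in> (\<lambda>w. w +o K') ` W'" using TW by (auto simp: im)
    next
      fix D assume "D \<in> (\<lambda>w. w +o K') ` W'"
      then obtain w' where "w' \<in> W'" "D = w' +o K'" by blast
      moreover then obtain w where "w \<in> W" "w' - T w \<in> K'" using surj by blast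
      ultimately have "D = induced_map K' T (w +o K)" "w \<in> W"
        by (simp_all add: im coset_eq_iff[OF K(2)])
      then show "D \<in> induced_map K' T ` (\<lambda>w. w +o K) ` W" by blast
    qed
  qed
  then show ?thesis
    unfolding quotient_iso_def
    by (auto simp: im coset_add K scale_coset_coset linear_add[OF T] linear_cmul[OF T])
qed

text \<open>The inverse of a bijection that respects the operations respects them too, provided sums
  and multiples stay in the domain of that bijection; for this \<open>Q\<^sub>1\<close> is the full
  set of cosets of elements of a subspace.\<close>

lemma quotient_iso_inv_into_comp:
  assumes "subspace K\<^sub>1" "subspace W\<^sub>1" and Q\<^sub>1: "Q\<^sub>1 = (\<lambda>w. w +o K\<^sub>1) ` W\<^sub>1"
    and 1: "quotient_iso K\<^sub>1 Q\<^sub>1 K' Q' j\<^sub>1" and 2: "quotient_iso K\<^sub>2 Q\<^sub>2 K' Q' j\<^sub>2"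
  shows "quotient_iso K\<^sub>2 Q\<^sub>2 K\<^sub>1 Q\<^sub>1 (inv_into Q\<^sub>1 j\<^sub>1 \<circ> j\<^sub>2)"
proof -
  let ?h = "inv_into Q\<^sub>1 j\<^sub>1 \<circ> j\<^sub>2"
  have b: "bij_betw j\<^sub>1 Q\<^sub>1 Q'" "bij_betw j\<^sub>2 Q\<^sub>2 Q'" using 1 2 unfolding quotient_iso_def by auto
  have h: "?h C \<in> Q\<^sub>1" "j\<^sub>1 (?h C) = j\<^sub>2 C" if "C \<in> Q\<^sub>2" for C
  proof -
    have "j\<^sub>2 C \<in> j\<^sub>1 ` Q\<^sub>1" using that b bij_betwE bij_betw_imp_surj_on by metis
    then show "?h C \<in> Q\<^sub>1" "j\<^sub>1 (?h C) = j\<^sub>2 C" by (auto simp: inv_into_into f_inv_into_f)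
  qed
  have closed: "C + D \<in> Q\<^sub>1" "scale_coset K\<^sub>1 s C \<in> Q\<^sub>1" if "C \<in> Q\<^sub>1" "D \<in> Q\<^sub>1" for C D s
    using that assms(2) unfolding Q\<^sub>1
    by (auto simp: coset_add[OF assms(1)] scale_coset_coset[OF assms(1)] intro!: imageI subspace_add subspace_scale)
  have eq: "?h C = D" if "j\<^sub>2 C = j\<^sub>1 D" "D \<in> Q\<^sub>1" for C D
    using that b(1) bij_betw_inv_into_left by fastforce
  have "bij_betw ?h Q\<^sub>2 Q\<^sub>1" using b bij_betw_inv_into bij_betw_trans by blast
  moreover have "?h (C + D) = ?h C + ?h D" if "C \<in> Q\<^sub>2" "D \<in> Q\<^sub>2" for C D
    using 1 2 h[OF that(1)] h[OF that(2)] that closed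
    by (intro eq) (auto simp: quotient_iso_def)
  moreover have "?h (scale_coset K\<^sub>2 s C) = scale_coset K\<^sub>1 s (?h C)" if "C \<in> Q\<^sub>2" for C s
    using 1 2 h[OF that] that closed
    by (intro eq) (auto simp: quotient_iso_def)
  ultimately show ?thesis unfolding quotient_iso_def by blast
qed

section \<open>Smoothness of inverse maps\<close>

text \<open>By Cramer's rule the derivative of the inverse is a rational expression in the entries
  of the derivative of \<open>g\<close> at the inverse point. If the inverse has order
  \<open>k\<close>, so has this expression, and the order of the inverse rises by one.\<close>

lemma Ck_on_inv_into:
  fixes g :: "real ^ 'l::finite \<Rightarrow> real ^ 'l"
  assumes U: "open U" and V: "open V" and g: "\<And>k. Ck_on k U g" and bij: "bij_betw g U V"
    and inj: "\<And>x v. x \<in> U \<Longrightarrow> frechet_derivative g (at x) v = 0 \<Longrightarrow> v = 0"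
  shows "Ck_on k V (inv_into U g)"
proof -
  define h where "h = inv_into U g"
  define A where "A x = matrix (frechet_derivative g (at x))" for x
  define c where "c x v = (\<chi> k. det (\<chi> i j. if j = k then v $ i else A x $ i $ j) / det (A x))" for x v
  have hU: "h y \<in> U" "g (h y) = y" if "y \<in> V" for y
    using that bij bij_betw_inv_into_right[OF bij] bij_betwE[OF bij_betw_inv_into[OF bij]]
    unfolding h_def by auto
  have dg: "(g has_derivative frechet_derivative g (at x)) (at x)" if "x \<in> U" for x
    by (rule Ck_on_has_derivative[OF g that])
  have det: "det (A x) \<noteq> 0" if "x \<in> U" for x
    unfolding A_def
    using det_nz_iff_inj[OF has_derivative_linear[OF dg[OF that]]]
      linear_injective_0[OF has_derivative_linear[OF dg[OF that]]] inj[OF that] by blast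
  have dh: "(h has_derivative c (h y)) (at y)" if y: "y \<in> V" for y
  proof (rule has_derivative_inverse_strong_x[where g = h and f' = "frechet_derivative g (at (h y))",
        OF U hU(1)[OF y] Ck_on_imp_continuous_on[OF g[of 0]] _ dg[OF hU(1)[OF y]] _ hU(2)[OF y]])
    show "h (g x) = x" if "x \<in> U" for x
      using that bij unfolding h_def bij_betw_def by simp
    show "frechet_derivative g (at (h y)) \<circ> c (h y) = id"
    proof
      fix v
      have "A (h y) *v c (h y) v = v"
        using cramer[OF det[OF hU(1)[OF y]], of "c (h y) v" v] unfolding c_def by simp
      then show "(frechet_derivative g (at (h y)) \<circ> c (h y)) v = id v"
        unfolding A_def
        using matrix_works[OF linear_matrix_vector_mul_eq[THEN iffD2, OF has_derivative_linear[OF dg[OF hU(1)[OF y]]]]]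
        by simp
    qed
  qed
  have "Ck_on k V h"
  proof (induction k)
    case 0
    then show ?case
      using dh by (auto intro!: continuous_at_imp_continuous_on has_derivative_continuous)
  next
    case (Suc k)
    have Ak: "Ck_on k V (\<lambda>y. A (h y) $ i $ j)" for i j
      unfolding A_def matrix_def
      by (simp, rule Ck_on_compose[OF V Suc, where V = U])
        (use hU in \<open>auto intro!: Ck_on_vec_nth U Ck_on_frechet_derivative g\<close>)
    show ?case
    proof (rule Ck_on_SucI[OF V dh])
      show "Ck_on k V (\<lambda>y. c (h y) v)" for v
      proof (rule Ck_on_vec[OF V])
        fix l
        have "Ck_on k V (\<lambda>y. (\<chi> i j. if j = l then v $ i else A (h y) $ i $ j) $ i $ j)" for i j
          by (cases "j = l") (simp_all add: Ak Ck_on_const V)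
        then show "Ck_on k V (\<lambda>y. c (h y) v $ l)"
          unfolding c_def vec_lambda_beta
          by (intro Ck_on_divide Ck_on_det V Ak) (use det hU in auto)
      qed
    qed
  qed
  then show ?thesis unfolding h_def .
qed

section \<open>Demand\<close>

lemma open_goods_space: "open (goods_space :: (real ^ 'l::finite) set)"
proof -
  have "goods_space = (\<Inter>k. {x :: real ^ 'l. 0 < x $ k})" by (auto simp: goods_space_def)
  moreover have "open {x :: real ^ 'l. 0 < x $ k}" for k
    by (intro open_Collect_less continuous_intros)
  ultimately show ?thesis using open_INT[of UNIV "\<lambda>k. {x :: real ^ 'l. 0 < x $ k}"] by simp
qed

lemma convex_goods_space: "convex (goods_space :: (real ^ 'l::finite) set)"
  unfolding convex_def goods_space_def
  by (auto intro: pos_add_strict) (metis add_nonneg_pos add_pos_nonneg less_eq_real_def mult_nonneg_nonneg mult_pos_pos zero_less_one add.right_neutral add_0)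

lemma inner_goods_space_pos:
  assumes "p \<in> goods_space" "x \<in> goods_space" shows "0 < p \<bullet> (x :: real ^ 'l::finite)"
  using assms unfolding inner_vec_def goods_space_def by (auto intro!: sum_pos)

locale utility =
  fixes f :: "real ^ 'l::finite \<Rightarrow> real"
  assumes utility_function: "utility_function f"
begin

lemma Ck_f: "Ck_on k goods_space f"
  using utility_function smooth_on_imp_Ck_on[OF open_goods_space] unfolding utility_function_def by blast

lemma gradient_pos: "x \<in> goods_space \<Longrightarrow> 0 < gradient f x $ k"
  using utility_function unfolding utility_function_def goods_space_def by auto

lemma gradient_goods: "x \<in> goods_space \<Longrightarrow> gradient f x \<in> goods_space"
  using utility_function unfolding utility_function_def by auto

lemma has_derivative_f:
  assumes "x \<in> goods_space" shows "(f has_derivative (\<lambda>v. gradient f x \<bullet> v)) (at x)"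
proof -
  have d: "(f has_derivative frechet_derivative f (at x)) (at x)"
    by (rule Ck_on_has_derivative[OF Ck_f assms])
  have "frechet_derivative f (at x) v = gradient f x \<bullet> v" for v
  proof -
    have "frechet_derivative f (at x) v = frechet_derivative f (at x) (\<Sum>k\<in>UNIV. v $ k *\<^sub>R axis k 1)"
      using basis_expansion[of v] by (simp add: scalar_mult_eq_scaleR)
    also have "\<dots> = (\<Sum>k\<in>UNIV. v $ k *\<^sub>R frechet_derivative f (at x) (axis k 1))"
      using has_derivative_linear[OF d] by (simp only: linear_sum linear_cmul o_def)
    finally show ?thesis by (simp add: gradient_def inner_vec_def mult.commute)
  qed
  then show ?thesis using d by presburger
qed

lemma Ck_gradient: "Ck_on k goods_space (gradient f)"
  by (rule Ck_on_vec[OF open_goods_space]) (simp add: gradient_def Ck_on_frechet_derivative[OF Ck_f])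

abbreviation H :: "real ^ 'l \<Rightarrow> real ^ 'l \<Rightarrow> real ^ 'l" where
  "H x \<equiv> frechet_derivative (gradient f) (at x)"

lemma has_derivative_gradient: "x \<in> goods_space \<Longrightarrow> (gradient f has_derivative H x) (at x)"
  by (rule Ck_on_has_derivative[OF Ck_gradient])

text \<open>\<open>hessian f x\<close> is the transpose of the matrix of \<open>H x\<close>, and
  transposition does not change a quadratic form.\<close>

lemma hessian_form:
  assumes "x \<in> goods_space"
  shows "v \<bullet> (hessian f x *v v) = v \<bullet> H x v"
proof -
  have lin: "linear (H x)" using has_derivative_linear[OF has_derivative_gradient[OF assms]] .
  have "((\<lambda>y. gradient f y $ b) has_derivative (\<lambda>v. H x v $ b)) (at x)" for b
    by (rule bounded_linear.has_derivative[OF bounded_linear_vec_nth has_derivative_gradient[OF assms]])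
  from frechet_derivative_at[OF this]
  have hess: "hessian f x $ a $ b = H x (axis a 1) $ b" for a b
    by (simp add: hessian_def gradient_def[of "\<lambda>y. gradient f y $ b" for b] fun_eq_iff)
  have "H x v = (\<Sum>a\<in>UNIV. v $ a *\<^sub>R H x (axis a 1))"
  proof -
    have "H x v = H x (\<Sum>a\<in>UNIV. v $ a *\<^sub>R axis a 1)"
      using basis_expansion[of v] by (simp add: scalar_mult_eq_scaleR)
    then show ?thesis using lin by (simp only: linear_sum linear_cmul o_def)
  qed
  then have "v \<bullet> H x v = (\<Sum>b\<in>UNIV. \<Sum>a\<in>UNIV. v $ b * (v $ a * hessian f x $ a $ b))"
    by (simp add: inner_vec_def hess sum_distrib_left)
  also have "\<dots> = (\<Sum>a\<in>UNIV. \<Sum>b\<in>UNIV. v $ b * (v $ a * hessian f x $ a $ b))"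
    by (rule sum.swap)
  finally show ?thesis
    by (simp add: inner_vec_def matrix_vector_mult_def sum_distrib_left mult_ac)
qed

lemma hessian_neg:
  "x \<in> goods_space \<Longrightarrow> gradient f x \<bullet> v = 0 \<Longrightarrow> v \<noteq> 0 \<Longrightarrow> v \<bullet> H x v < 0"
  using utility_function hessian_form unfolding utility_function_def by metis

text \<open>Along a segment every critical point of the utility is a strict local maximum, so a segment
  that starts in a direction of nonincreasing utility has its minimum only at the other end.\<close>

lemma utility_decreases:
  assumes x: "x \<in> goods_space" and y: "y \<in> goods_space" and "y \<noteq> x"
    and start: "gradient f x \<bullet> (y - x) \<le> 0"
  shows "f y < f x"
proof -
  define v where "v = y - x"
  define c where "c t = x + t *\<^sub>R v" for t
  define g where "g t = f (c t)" for t
  define g' where "g' t = gradient f (c t) \<bullet> v" for t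
  have v0: "v \<noteq> 0" using \<open>y \<noteq> x\<close> by (simp add: v_def)
  have cX: "c t \<in> goods_space" if "0 \<le> t" "t \<le> 1" for t
  proof -
    have "(1 - t) *\<^sub>R x + t *\<^sub>R y \<in> goods_space"
      using convexD[OF convex_goods_space x y, of "1 - t" t] that by simp
    then show ?thesis by (simp add: c_def v_def algebra_simps)
  qed
  have dc: "(c has_derivative (\<lambda>s. s *\<^sub>R v)) (at t)" for t
    unfolding c_def by (auto intro!: derivative_eq_intros)
  have dg: "(g has_real_derivative g' t) (at t)" if "0 \<le> t" "t \<le> 1" for t
    unfolding g_def g'_def has_field_derivative_def
    using has_derivative_compose[OF dc has_derivative_f[OF cX[OF that]]]
    by (simp add: mult_commute_abs)
  have dg': "(g' has_real_derivative v \<bullet> H (c t) v) (at t)" if "0 \<le> t" "t \<le> 1" for t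
  proof -
    have "((\<lambda>t. gradient f (c t)) has_derivative (\<lambda>s. H (c t) (s *\<^sub>R v))) (at t)"
      by (rule has_derivative_compose[OF dc has_derivative_gradient[OF cX[OF that]]])
    from has_derivative_inner_left[OF this, of v] show ?thesis
      unfolding g'_def has_field_derivative_def
      using linear_cmul[OF has_derivative_linear[OF has_derivative_gradient[OF cX[OF that]]]]
      by (simp add: inner_commute mult_commute_abs)
  qed
  have neg: "v \<bullet> H (c t) v < 0" if "0 \<le> t" "t \<le> 1" "g' t = 0" for t
    using hessian_neg[OF cX[OF that(1,2)]] that(3) v0 by (simp add: g'_def)
  \<comment> \<open>A point with nonpositive slope can be undercut further right: directly if the
    slope is negative, and if it is zero because the negative second derivative makes the slope
    negative just afterwards.\<close>
  have lower: "\<exists>s>t. s \<le> 1 \<and> g s < g t" if t: "0 \<le> t" "t < 1" "g' t \<le> 0" for t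
  proof (cases "g' t < 0")
    case True
    then obtain d where "d > 0" "\<And>h. 0 < h \<Longrightarrow> h < d \<Longrightarrow> g (t + h) < g t"
      using DERIV_neg_dec_right[OF dg True] t by auto
    then show ?thesis using t by (intro exI[of _ "t + min (d / 2) (1 - t)"]) auto
  next
    case False
    then have 0: "g' t = 0" using t by simp
    then obtain d where d: "d > 0" "\<And>h. 0 < h \<Longrightarrow> h < d \<Longrightarrow> g' (t + h) < g' t"
      using DERIV_neg_dec_right[OF dg'[of t] neg[of t]] t by auto
    define s where "s = t + min (d / 2) (1 - t)"
    have s: "t < s" "s \<le> 1" "s < t + d" using d(1) t by (auto simp: s_def)
    obtain z where z: "t < z" "z < s" "g s - g t = (s - t) * g' z"
      using MVT2[OF s(1), of g g'] dg s t by auto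
    have "g' z < 0" using d(2)[of "z - t"] z s 0 by auto
    then have "g s < g t" using z s by (metis diff_gt_0_iff_gt mult_pos_neg diff_less_0_iff_less)
    then show ?thesis using s by blast
  qed
  have "continuous_on {0..1} g"
    using dg by (intro continuous_at_imp_continuous_on ballI DERIV_isCont) auto
  then obtain m where m: "m \<in> {0..1}" "\<And>t. t \<in> {0..1} \<Longrightarrow> g m \<le> g t"
    using continuous_attains_inf[of "{0..1}" g] by auto
  have g'0: "g' 0 \<le> 0" using start by (simp add: g'_def c_def v_def)
  \<comment> \<open>At a minimum \<open>m < 1\<close> a nonpositive slope contradicts
    \<open>lower\<close>, while a positive slope forces \<open>m > 0\<close> and allows a step to
    the left.\<close>
  have "m = 1"
  proof (rule ccontr)
    assume "m \<noteq> 1"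
    then have m': "0 \<le> m" "m < 1" using m(1) by auto
    show False
    proof (cases "g' m \<le> 0")
      case True
      then obtain s where "s > m" "s \<le> 1" "g s < g m" using lower[OF m'] by blast
      then show False using m(2)[of s] m' by auto
    next
      case False
      then have "m \<noteq> 0" "g' m > 0" using g'0 by auto
      then obtain d where d: "d > 0" "\<And>h. 0 < h \<Longrightarrow> h < d \<Longrightarrow> g (m - h) < g m"
        using DERIV_pos_inc_left[OF dg[of m]] m' by auto
      define h where "h = min (d / 2) m"
      have "0 < h" "h < d" "h \<le> m" using d(1) m' \<open>m \<noteq> 0\<close> by (auto simp: h_def)
      then show False using d(2)[of h] m(2)[of "m - h"] m' by auto
    qed
  qed
  moreover obtain s where "s > 0" "s \<le> 1" "g s < g 0" using lower[of 0] g'0 by auto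
  ultimately have "g 1 < g 0" using m(2)[of s] by auto
  then show ?thesis by (simp add: g_def c_def v_def)
qed

text \<open>If points of the upper set tended to a boundary point, the level set would meet the segments
  joining them to a sequence tending to the origin; the limits of these intersection points are
  multiples of the boundary point.\<close>

lemma closed_upper_set:
  assumes w: "w \<in> goods_space"
  shows "closed {x \<in> goods_space. f w \<le> f x}"
  unfolding closed_sequential_limits
proof (intro allI impI, elim conjE)
  fix X x assume X: "\<forall>k. X k \<in> {x \<in> goods_space. f w \<le> f x}" and lim: "X \<longlonglongrightarrow> x"
  \<comment> \<open>A null sequence starting at 1/2: every term is strictly below 1, so that the
    scaled \<open>w\<close> has strictly less utility than \<open>w\<close>.\<close>
  define s where "s k = inverse (real (Suc (Suc k)))" for k
  have s: "0 < s k" "s k < 1" for k by (auto simp: s_def inverse_less_1_iff)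
  have swX: "s k *\<^sub>R w \<in> goods_space" for k
    using w s[of k] by (auto simp: goods_space_def)
  have wpos: "0 < gradient f w \<bullet> w"
    by (rule inner_goods_space_pos[OF gradient_goods[OF w] w])
  have low: "f (s k *\<^sub>R w) < f w" for k
  proof (rule utility_decreases[OF w swX])
    have "(1 - s k) * (gradient f w \<bullet> w) \<ge> 0" using wpos s(2)[of k] by (intro mult_nonneg_nonneg) auto
    then show "gradient f w \<bullet> (s k *\<^sub>R w - w) \<le> 0" by (simp add: inner_diff_right algebra_simps)
    show "s k *\<^sub>R w \<noteq> w"
    proof
      assume "s k *\<^sub>R w = w"
      then have "(s k - 1) *\<^sub>R w = 0" by (simp add: algebra_simps)
      then have "w = 0" using s(2)[of k] by simp
      then show False using wpos by simp
    qed
  qed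
  define y where "y k t = (1 - t) *\<^sub>R X k + t *\<^sub>R (s k *\<^sub>R w)" for k t
  have yX: "y k t \<in> goods_space" if "0 \<le> t" "t \<le> 1" for k t
    unfolding y_def using X swX that by (intro convexD[OF convex_goods_space]) auto
  have "\<exists>t. 0 \<le> t \<and> t \<le> 1 \<and> f (y k t) = f w" for k
  proof (rule IVT2')
    show "f (y k 1) \<le> f w" "f w \<le> f (y k 0)" using low[of k] X by (auto simp: y_def)
    have "continuous_on {0..1} (y k)" unfolding y_def by (intro continuous_intros)
    then show "continuous_on {0..1} (\<lambda>t. f (y k t))"
      by (rule continuous_on_compose2[OF Ck_on_imp_continuous_on[OF Ck_f]]) (use yX in auto)
  qed auto
  then obtain t where t: "\<And>k. 0 \<le> t k \<and> t k \<le> 1 \<and> f (y k (t k)) = f w" by metis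
  then have "\<forall>k. t k \<in> {0..1}" by auto
  then obtain l \<phi> where l: "l \<in> {0..1}" "strict_mono \<phi>" "(t \<circ> \<phi>) \<longlonglongrightarrow> l"
    using compact_Icc[of 0 "1::real"] unfolding compact_def by metis
  have s0: "s \<longlonglongrightarrow> 0" unfolding s_def
    using LIMSEQ_inverse_real_of_nat[THEN LIMSEQ_Suc] by simp
  have "(\<lambda>k. (1 - (t \<circ> \<phi>) k) *\<^sub>R (X \<circ> \<phi>) k + (t \<circ> \<phi>) k *\<^sub>R ((s \<circ> \<phi>) k *\<^sub>R w))
      \<longlonglongrightarrow> (1 - l) *\<^sub>R x + l *\<^sub>R (0 *\<^sub>R w)"
    by (intro tendsto_intros l LIMSEQ_subseq_LIMSEQ[OF lim l(2)] LIMSEQ_subseq_LIMSEQ[OF s0 l(2)])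
  then have "(\<lambda>k. y (\<phi> k) (t (\<phi> k))) \<longlonglongrightarrow> (1 - l) *\<^sub>R x" by (simp add: y_def)
  moreover have "closed {x \<in> goods_space. f x = f w}"
    using utility_function unfolding utility_function_def by blast
  moreover have "y (\<phi> k) (t (\<phi> k)) \<in> {x \<in> goods_space. f x = f w}" for k using t yX by auto
  ultimately have "(1 - l) *\<^sub>R x \<in> {x \<in> goods_space. f x = f w}"
    using closed_sequentially[of "{x \<in> goods_space. f x = f w}" "\<lambda>k. y (\<phi> k) (t (\<phi> k))"] by simp
  then have lx: "(1 - l) *\<^sub>R x \<in> goods_space" by simp
  \<comment> \<open>Since \<open>l \<le> 1\<close>, positive coordinates of
    \<open>(1 - l) *\<^sub>R x\<close> force those of \<open>x\<close> to be positive.\<close>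
  then have xX: "x \<in> goods_space"
    using l(1) by (auto simp: goods_space_def zero_less_mult_iff)
  then have "isCont f x"
    using has_derivative_continuous[OF has_derivative_f] by blast
  then have "(\<lambda>k. f (X k)) \<longlonglongrightarrow> f x" using lim by (rule isCont_tendsto_compose)
  then have "f w \<le> f x" by (rule LIMSEQ_le_const) (use X in auto)
  then show "x \<in> {x \<in> goods_space. f w \<le> f x}" using xX by simp
qed

text \<open>The budget set is not closed, as it misses the boundary of the orthant. Cutting it with
  the upper set of \<open>w\<close>, which is closed in the whole space, makes it compact, and
  everything cut off is worse than \<open>w\<close>.\<close>

lemma demand_exists:
  assumes p: "p \<in> goods_space" and w: "w \<in> goods_space"
  shows "\<exists>x\<in>goods_space. p \<bullet> x \<le> p \<bullet> w \<and> (\<forall>y\<in>goods_space. p \<bullet> y \<le> p \<bullet> w \<longrightarrow> f y \<le> f x)"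
proof -
  define K where "K = {x \<in> goods_space. f w \<le> f x} \<inter> {x. p \<bullet> x \<le> p \<bullet> w}"
  have "x \<in> cbox 0 (\<chi> k. p \<bullet> w / p $ k)" if "x \<in> K" for x
  proof -
    have x: "x \<in> goods_space" "p \<bullet> x \<le> p \<bullet> w" using that by (auto simp: K_def)
    have "p $ k * x $ k \<le> p \<bullet> w" for k
    proof -
      have "p $ k * x $ k \<le> (\<Sum>j\<in>UNIV. p $ j * x $ j)"
        by (rule member_le_sum) (use p x in \<open>auto simp: goods_space_def less_imp_le\<close>)
      then show ?thesis using x(2) by (simp add: inner_vec_def)
    qed
    then show ?thesis
      using p x(1) by (auto simp: mem_box_cart goods_space_def less_imp_le pos_le_divide_eq mult.commute)
  qed
  then have "bounded K" using bounded_cbox bounded_subset by blast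
  moreover have "closed K"
    unfolding K_def by (intro closed_Int closed_upper_set w closed_halfspace_le)
  ultimately have "compact K" using compact_eq_bounded_closed by blast
  moreover have "w \<in> K" using w by (simp add: K_def)
  moreover have "continuous_on K f"
    by (rule continuous_on_subset[OF Ck_on_imp_continuous_on[OF Ck_f]]) (auto simp: K_def)
  ultimately obtain x where x: "x \<in> K" "\<And>y. y \<in> K \<Longrightarrow> f y \<le> f x"
    using continuous_attains_sup[of K f] by blast
  have "f y \<le> f x" if "y \<in> goods_space" "p \<bullet> y \<le> p \<bullet> w" for y
    using x(2)[of y] x(2)[OF \<open>w \<in> K\<close>] that by (cases "f w \<le> f y") (auto simp: K_def)
  then show ?thesis using x(1) by (auto simp: K_def)
qed

text \<open>If the slope were positive, a small step along \<open>v\<close> would stay affordable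
  and raise the utility.\<close>

lemma gradient_at_max:
  assumes x: "x \<in> goods_space" and max: "\<And>y. y \<in> goods_space \<Longrightarrow> p \<bullet> y \<le> I \<Longrightarrow> f y \<le> f x"
    and e: "0 < e" "\<And>t. 0 < t \<Longrightarrow> t < e \<Longrightarrow> p \<bullet> (x + t *\<^sub>R v) \<le> I"
  shows "gradient f x \<bullet> v \<le> 0"
proof (rule ccontr)
  assume "\<not> gradient f x \<bullet> v \<le> 0"
  have "((\<lambda>t. x + t *\<^sub>R v) has_derivative (\<lambda>s. s *\<^sub>R v)) (at (0::real))"
    by (auto intro!: derivative_eq_intros)
  from has_derivative_compose[OF this, of f "\<lambda>v. gradient f x \<bullet> v"] has_derivative_f[OF x]
  have "((\<lambda>t. f (x + t *\<^sub>R v)) has_real_derivative gradient f x \<bullet> v) (at 0)"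
    unfolding has_field_derivative_def by (simp add: mult_commute_abs)
  from DERIV_pos_inc_right[OF this] \<open>\<not> gradient f x \<bullet> v \<le> 0\<close>
  obtain d where d: "d > 0" "\<And>h. 0 < h \<Longrightarrow> h < d \<Longrightarrow> f x < f (x + h *\<^sub>R v)" by auto
  have "open ((\<lambda>t::real. x + t *\<^sub>R v) -` goods_space)"
    by (intro open_vimage open_goods_space continuous_intros)
  moreover have "0 \<in> (\<lambda>t::real. x + t *\<^sub>R v) -` goods_space" using x by simp
  ultimately obtain d' where d': "d' > 0" "\<And>t. dist t 0 < d' \<Longrightarrow> x + t *\<^sub>R v \<in> goods_space"
    unfolding open_dist by blast
  define t where "t = min (min d d') e / 2"
  have "0 < t" "t < d" "t < d'" "t < e" using d(1) d'(1) e(1) by (auto simp: t_def min_def)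
  then show False
    using d(2)[of t] max[of "x + t *\<^sub>R v"] d'(2)[of t] e(2)[of t] by auto
qed

end

locale utility_numeraire = utility f for f :: "real ^ 'l::finite \<Rightarrow> real" +
  fixes n :: 'l
begin

text \<open>The normalized prices supporting \<open>x\<close>. The inverse demand \<open>G\<close> stores the income in the slot
  of the numeraire, whose price is redundant, and thereby maps between spaces of equal dimension.\<close>

definition q :: "real ^ 'l \<Rightarrow> real ^ 'l" where
  "q x = (1 / gradient f x $ n) *\<^sub>R gradient f x"

definition G :: "real ^ 'l \<Rightarrow> real ^ 'l" where
  "G x = (\<chi> k. if k = n then q x \<bullet> x else q x $ k)"

lemma gradient_q: "x \<in> goods_space \<Longrightarrow> gradient f x = gradient f x $ n *\<^sub>R q x"
  using gradient_pos[of x n] by (simp add: q_def)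

lemma q_n: "x \<in> goods_space \<Longrightarrow> q x $ n = 1"
  using gradient_pos[of x n] by (simp add: q_def)

lemma q_goods: "x \<in> goods_space \<Longrightarrow> q x \<in> goods_space"
  using gradient_pos by (auto simp: q_def goods_space_def)

lemma q_strict_max:
  assumes "x \<in> goods_space" "z \<in> goods_space" "z \<noteq> x" "q x \<bullet> z \<le> q x \<bullet> x"
  shows "f z < f x"
proof (rule utility_decreases[OF assms(1-3)])
  have "gradient f x $ n * (q x \<bullet> (z - x)) \<le> 0"
    using gradient_pos[OF assms(1), of n] assms(4) by (intro mult_nonneg_nonpos) (auto simp: inner_diff_right)
  then show "gradient f x \<bullet> (z - x) \<le> 0" by (subst gradient_q[OF assms(1)]) simp
qed

lemma G_eq_iff:
  assumes "x \<in> goods_space" "p $ n = 1"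
  shows "G x = (\<chi> k. if k = n then I else p $ k) \<longleftrightarrow> q x = p \<and> p \<bullet> x = I"
proof
  assume G: "G x = (\<chi> k. if k = n then I else p $ k)"
  have "q x $ k = p $ k" for k
    using G[THEN arg_cong, of "\<lambda>v. v $ k"] q_n[OF assms(1)] assms(2)
    by (cases "k = n") (auto simp: G_def)
  then have "q x = p" by (simp add: vec_eq_iff)
  moreover have "q x \<bullet> x = I" using G[THEN arg_cong, of "\<lambda>v. v $ n"] by (simp add: G_def)
  ultimately show "q x = p \<and> p \<bullet> x = I" by simp
next
  assume "q x = p \<and> p \<bullet> x = I"
  then show "G x = (\<chi> k. if k = n then I else p $ k)" by (simp add: G_def cong: if_cong)
qed

text \<open>Points with the same supporting prices and income lie in each other's budget sets, so
  each would be strictly worse than the other.\<close>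

lemma inj_on_G: "inj_on G goods_space"
proof (rule inj_onI, rule ccontr)
  fix x y assume xy: "x \<in> goods_space" "y \<in> goods_space" "G x = G y" "x \<noteq> y"
  have "q x = q y \<and> q y \<bullet> x = q y \<bullet> y"
    using G_eq_iff[of x "q y" "q y \<bullet> y"] xy q_n[OF xy(2)] by (simp add: G_def)
  then show False
    using q_strict_max[OF xy(1,2)] q_strict_max[OF xy(2,1)] xy(4) by auto
qed

text \<open>A maximizer exhausts the income, since more of the numeraire is always better. Then
  every \<open>v\<close> orthogonal to the prices is feasible together with \<open>- v\<close>,
  which makes the gradient a multiple of \<open>p\<close>.\<close>

lemma supported:
  assumes p: "p \<in> goods_space" "p $ n = 1" and w: "w \<in> goods_space"
  shows "\<exists>x\<in>goods_space. q x = p \<and> p \<bullet> x = p \<bullet> w"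
proof -
  obtain x where x: "x \<in> goods_space" "p \<bullet> x \<le> p \<bullet> w"
      and max: "\<And>y. y \<in> goods_space \<Longrightarrow> p \<bullet> y \<le> p \<bullet> w \<Longrightarrow> f y \<le> f x"
    using demand_exists[OF p(1) w] by blast
  have pn: "p \<bullet> axis k 1 = p $ k" for k by (simp add: inner_axis)
  have gn: "gradient f x \<bullet> axis k 1 = gradient f x $ k" for k by (simp add: inner_axis)
  have "\<not> p \<bullet> x < p \<bullet> w"
  proof
    assume "p \<bullet> x < p \<bullet> w"
    then have "gradient f x \<bullet> axis n 1 \<le> 0"
      by (intro gradient_at_max[OF x(1) max, where e = "p \<bullet> w - p \<bullet> x"])
        (auto simp: inner_add_right pn p(2))
    then show False using gradient_pos[OF x(1), of n] by (simp add: gn)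
  qed
  then have eq: "p \<bullet> x = p \<bullet> w" using x(2) by simp
  have le: "gradient f x \<bullet> v \<le> 0" if v: "p \<bullet> v = 0" for v
  proof (rule gradient_at_max[where p = p and I = "p \<bullet> w" and e = 1, OF x(1) max])
    show "p \<bullet> (x + t *\<^sub>R v) \<le> p \<bullet> w" for t using v eq by (simp add: inner_add_right)
  qed auto
  have perp: "gradient f x \<bullet> v = 0" if "p \<bullet> v = 0" for v
    using le[of v] le[of "- v"] that by simp
  have "q x $ k = p $ k" for k
  proof -
    \<comment> \<open>Exchanging the numeraire for good \<open>k\<close> at market prices is
      orthogonal to \<open>p\<close>, because \<open>p $ n = 1\<close>.\<close>
    have "gradient f x \<bullet> (axis k 1 - p $ k *\<^sub>R axis n 1) = 0"
      by (rule perp) (simp add: inner_diff_right pn p(2))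
    then show ?thesis
      using gradient_pos[OF x(1), of n] by (simp add: q_def inner_diff_right gn)
  qed
  then have "q x = p" by (simp add: vec_eq_iff)
  then show ?thesis using x(1) eq by blast
qed

lemma bij_betw_G: "bij_betw G goods_space goods_space"
  unfolding bij_betw_def
proof (intro conjI inj_on_G equalityI subsetI)
  show "y \<in> goods_space" if "y \<in> G ` goods_space" for y
    using that q_goods inner_goods_space_pos[OF q_goods] by (auto simp: G_def goods_space_def)
  fix y :: "real ^ 'l" assume y: "y \<in> goods_space"
  define p :: "real ^ 'l" where "p = (\<chi> k. if k = n then 1 else y $ k)"
  \<comment> \<open>Equal amounts of all goods, scaled to be worth \<open>y $ n\<close>:
    \<open>supported\<close> expresses incomes as values of endowments.\<close>
  define w :: "real ^ 'l" where "w = (\<chi> k. y $ n / (p \<bullet> 1))"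
  have p: "p \<in> goods_space" "p $ n = 1" using y by (auto simp: p_def goods_space_def)
  have "(1 :: real ^ 'l) \<in> goods_space" by (simp add: goods_space_def)
  then have p1: "p \<bullet> 1 > 0" by (rule inner_goods_space_pos[OF p(1)])
  then have w: "w \<in> goods_space" using y by (auto simp: w_def goods_space_def)
  have "w = (y $ n / (p \<bullet> 1)) *\<^sub>R 1" by (simp add: w_def vec_eq_iff)
  then have "p \<bullet> w = y $ n" using p1 by simp
  then obtain x where x: "x \<in> goods_space" "q x = p" "p \<bullet> x = y $ n"
    using supported[OF p w] by auto
  then have "G x = (\<chi> k. if k = n then y $ n else p $ k)" using G_eq_iff[OF x(1) p(2)] by simp
  also have "\<dots> = y" by (simp add: vec_eq_iff p_def)
  finally show "y \<in> G ` goods_space" using x(1) by blast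
qed

lemma Ck_q: "Ck_on k goods_space q"
  unfolding q_def
  using gradient_pos
  by (intro Ck_on_scaleR Ck_on_divide Ck_on_const Ck_on_vec_nth Ck_gradient open_goods_space)
    (simp add: less_imp_neq[symmetric])

lemma Ck_G: "Ck_on k goods_space G"
proof (rule Ck_on_vec[OF open_goods_space])
  fix j show "Ck_on k goods_space (\<lambda>x. G x $ j)"
    by (cases "j = n")
      (auto simp: G_def intro!: Ck_on_inner Ck_on_vec_nth Ck_q Ck_on_id open_goods_space)
qed

text \<open>If the derivative of \<open>G\<close> kills \<open>v\<close>, then supporting prices and
  income are stationary along \<open>v\<close>. So \<open>v\<close> is tangent to the indifference
  surface and the gradient changes only by a multiple of itself, whence
  \<open>v \<bullet> H x v = 0\<close>, against negative definiteness.\<close>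

lemma derivative_G_injective:
  assumes x: "x \<in> goods_space" and 0: "frechet_derivative G (at x) v = 0"
  shows "v = 0"
proof (rule ccontr)
  assume "v \<noteq> 0"
  let ?q = "frechet_derivative q (at x)"
  let ?G = "frechet_derivative G (at x)"
  have dq: "(q has_derivative ?q) (at x)" by (rule Ck_on_has_derivative[OF Ck_q x])
  have dG: "(G has_derivative ?G) (at x)" by (rule Ck_on_has_derivative[OF Ck_G x])
  have dGk: "((\<lambda>x. G x $ k) has_derivative (\<lambda>v. ?G v $ k)) (at x)" for k
    by (rule bounded_linear.has_derivative[OF bounded_linear_vec_nth dG])
  have dqk: "((\<lambda>x. q x $ k) has_derivative (\<lambda>v. ?q v $ k)) (at x)" for k
    by (rule bounded_linear.has_derivative[OF bounded_linear_vec_nth dq])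
  have "?q v $ k = 0" for k
  proof (cases "k = n")
    case True
    \<comment> \<open>Slot \<open>n\<close> of \<open>G\<close> carries the income instead of this
      component, which is constant because the numeraire price is 1.\<close>
    have "((\<lambda>x. q x $ n) has_derivative (\<lambda>v. 0)) (at x)"
      by (rule has_derivative_transform_within_open[OF has_derivative_const[of 1] open_goods_space x])
        (simp add: q_n)
    from has_derivative_unique[OF dqk this] True show ?thesis by metis
  next
    case False
    then have "(\<lambda>x. G x $ k) = (\<lambda>x. q x $ k)" by (simp add: G_def)
    with dGk[of k] have "((\<lambda>x. q x $ k) has_derivative (\<lambda>v. ?G v $ k)) (at x)" by simp
    from has_derivative_unique[OF dqk this] 0 show ?thesis by (metis zero_index)
  qed
  then have qv: "?q v = 0" by (simp add: vec_eq_iff)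
  have "(\<lambda>x. G x $ n) = (\<lambda>x. q x \<bullet> x)" by (simp add: G_def)
  with dGk[of n] have "((\<lambda>x. q x \<bullet> x) has_derivative (\<lambda>v. ?G v $ n)) (at x)" by simp
  from has_derivative_unique[OF has_derivative_inner[OF dq has_derivative_ident] this]
  have "q x \<bullet> v + ?q v \<bullet> x = ?G v $ n" by metis
  then have tangent: "q x \<bullet> v = 0" using qv 0 by simp
  let ?m = "\<lambda>x. gradient f x $ n"
  have dm: "(?m has_derivative (\<lambda>v. H x v $ n)) (at x)"
    by (rule bounded_linear.has_derivative[OF bounded_linear_vec_nth has_derivative_gradient[OF x]])
  have "(gradient f has_derivative (\<lambda>v. ?m x *\<^sub>R ?q v + H x v $ n *\<^sub>R q x)) (at x)"
    by (rule has_derivative_transform_within_open[OF has_derivative_scaleR[OF dm dq] open_goods_space x])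
      (simp add: gradient_q[symmetric])
  from has_derivative_unique[OF has_derivative_gradient[OF x] this]
  have "H x v = ?m x *\<^sub>R ?q v + H x v $ n *\<^sub>R q x" by metis
  then have "v \<bullet> H x v = v \<bullet> (H x v $ n *\<^sub>R q x)" using qv by simp
  also have "\<dots> = 0" using tangent by (simp add: inner_commute)
  finally have "v \<bullet> H x v = 0" .
  moreover have "gradient f x \<bullet> v = 0"
    by (subst gradient_q[OF x]) (simp add: tangent)
  ultimately show False using hessian_neg[OF x] \<open>v \<noteq> 0\<close> by force
qed

definition h :: "real ^ 'l \<Rightarrow> real ^ 'l" where "h = inv_into goods_space G"

lemma Ck_h: "Ck_on k goods_space h"
  unfolding h_def
  by (rule Ck_on_inv_into[OF open_goods_space open_goods_space Ck_G bij_betw_G derivative_G_injective])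

lemma
  assumes p: "p \<in> prices n" and w: "w \<in> goods_space"
  shows demand_eq: "demand f p w = h (\<chi> k. if k = n then p \<bullet> w else p $ k)"
    and walras: "p \<bullet> h (\<chi> k. if k = n then p \<bullet> w else p $ k) = p \<bullet> w"
proof -
  have p': "p \<in> goods_space" "p $ n = 1" using p by (auto simp: prices_def)
  obtain x where x: "x \<in> goods_space" "q x = p" "p \<bullet> x = p \<bullet> w"
    using supported[OF p' w] by blast
  then have "G x = (\<chi> k. if k = n then p \<bullet> w else p $ k)" using G_eq_iff[OF x(1) p'(2)] by simp
  then have hx: "h (\<chi> k. if k = n then p \<bullet> w else p $ k) = x"
    unfolding h_def using inv_into_f_f[OF inj_on_G x(1)] by simp
  then show "p \<bullet> h (\<chi> k. if k = n then p \<bullet> w else p $ k) = p \<bullet> w" using x by simp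
  have max: "f z < f x" if "z \<in> goods_space" "z \<noteq> x" "p \<bullet> z \<le> p \<bullet> w" for z
    using q_strict_max[OF x(1) that(1,2)] x that(3) by simp
  have "demand f p w = x"
    unfolding demand_def is_arg_max_def
  proof (rule the_equality)
    show "(x \<in> goods_space \<and> p \<bullet> x \<le> p \<bullet> w) \<and>
        \<not> (\<exists>y. (y \<in> goods_space \<and> p \<bullet> y \<le> p \<bullet> w) \<and> f x < f y)"
      using x max by force
  qed (use max x in force)
  then show "demand f p w = h (\<chi> k. if k = n then p \<bullet> w else p $ k)" using hx by simp
qed

end

section \<open>Tangent spaces of price sets, endowments and products\<close>

lemma smooth_retract_tangent_space:
  assumes "smooth_retract W M r" "x \<in> M" "(r has_derivative L) (at x)"
  shows "tangent_space M x = {v. L v = v}"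
  using smooth_retract.tangent_space_eq[OF assms(1,2)] frechet_derivative_at[OF assms(3)] by simp

definition drop_coord :: "'l::finite \<Rightarrow> real ^ 'l \<Rightarrow> real ^ 'l" where
  "drop_coord n y = (\<chi> k. if k = n then 0 else y $ k)"

text \<open>The numeraire price is overwritten by 1 rather than divided out, so that the retraction
  is affine with linear part \<open>drop_coord n\<close>.\<close>

definition normalize_price :: "'l::finite \<Rightarrow> real ^ 'l \<Rightarrow> real ^ 'l" where
  "normalize_price n p = drop_coord n p + axis n 1"

lemma linear_drop_coord: "linear (drop_coord n)"
  by (rule linearI) (auto simp: drop_coord_def vec_eq_iff)

lemma drop_coord_eq_iff: "drop_coord n y = y \<longleftrightarrow> y \<in> reduced_space n"
  by (auto simp: drop_coord_def reduced_space_def vec_eq_iff)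

lemma drop_coord_in: "drop_coord n y \<in> reduced_space n"
  by (auto simp: drop_coord_def reduced_space_def)

lemma subspace_reduced_space: "subspace (reduced_space n :: (real ^ 'l::finite) set)"
  by (auto simp: subspace_def reduced_space_def)

lemma normalize_price_has_derivative: "(normalize_price n has_derivative drop_coord n) (at p)"
proof -
  have "(drop_coord n has_derivative drop_coord n) (at p)"
    using linear_imp_has_derivative[OF linear_drop_coord] .
  from has_derivative_add_const[OF this] show ?thesis unfolding normalize_price_def .
qed

lemma normalize_price_eq: "p $ n = 1 \<Longrightarrow> normalize_price n p = p"
  by (auto simp: normalize_price_def drop_coord_def vec_eq_iff axis_def)

lemma normalize_price_in: "p \<in> goods_space \<Longrightarrow> normalize_price n p \<in> prices n"
  by (auto simp: normalize_price_def drop_coord_def prices_def goods_space_def axis_def)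

lemma prices_goods: "p \<in> prices n \<Longrightarrow> p \<in> goods_space" "p \<in> prices n \<Longrightarrow> p $ n = 1"
  by (auto simp: prices_def)

lemma Ck_normalize_price: "open U \<Longrightarrow> Ck_on k U (normalize_price n)"
  unfolding normalize_price_def
  by (rule Ck_on_add[OF _ Ck_on_linear[OF _ linear_drop_coord] Ck_on_const])

lemma open_endowments: "open (endowments :: (real ^ 'l::finite ^ 'm::finite) set)"
proof -
  have "endowments = (\<Inter>i. (\<lambda>\<omega> :: real ^ 'l ^ 'm. \<omega> $ i) -` goods_space)" by (auto simp: endowments_def)
  moreover have "open ((\<lambda>\<omega> :: real ^ 'l ^ 'm. \<omega> $ i) -` goods_space)" for i
    by (intro open_vimage open_goods_space continuous_intros)
  ultimately show ?thesis
    using open_INT[of UNIV "\<lambda>i. (\<lambda>\<omega> :: real ^ 'l ^ 'm. \<omega> $ i) -` goods_space"] by simp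
qed

lemma smooth_retract_prices: "smooth_retract goods_space (prices n) (normalize_price n)"
  by unfold_locales
    (auto simp: open_goods_space prices_goods normalize_price_in normalize_price_eq
      intro: Ck_normalize_price[OF open_goods_space])

lemma smooth_retract_open: "open U \<Longrightarrow> smooth_retract U U (\<lambda>x. x)"
  by unfold_locales (auto intro: Ck_on_id)

lemma smooth_retract_reduced_space: "smooth_retract UNIV (reduced_space n) (drop_coord n)"
  by unfold_locales
    (auto simp: drop_coord_in drop_coord_eq_iff intro: Ck_on_linear linear_drop_coord)

lemma smooth_retract_Times:
  fixes r :: "'a::euclidean_space \<Rightarrow> 'a" and r' :: "'b::euclidean_space \<Rightarrow> 'b"
  assumes "smooth_retract W M r" "smooth_retract W' M' r'"
  shows "smooth_retract (W \<times> W') (M \<times> M') (\<lambda>x. (r (fst x), r' (snd x)))"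
proof -
  interpret S: smooth_retract W M r by fact
  interpret S': smooth_retract W' M' r' by fact
  have op: "open (W \<times> W')" by (intro open_Times S.open_W S'.open_W)
  show ?thesis
  proof
    have "Ck_on k (W \<times> W') (\<lambda>x. r (fst x))" for k
      by (rule Ck_on_compose[OF op Ck_on_linear[OF op linear_fst] S.Ck]) auto
    moreover have "Ck_on k (W \<times> W') (\<lambda>x. r' (snd x))" for k
      by (rule Ck_on_compose[OF op Ck_on_linear[OF op linear_snd] S'.Ck]) auto
    ultimately show "Ck_on k (W \<times> W') (\<lambda>x. (r (fst x), r' (snd x)))" for k
      by (intro Ck_on_Pair op)
  qed (use S.M_subset S'.M_subset S.r_into S'.r_into S.r_id S'.r_id op in auto)
qed

lemma tangent_space_Times:
  fixes r :: "'a::euclidean_space \<Rightarrow> 'a" and r' :: "'b::euclidean_space \<Rightarrow> 'b"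
  assumes "smooth_retract W M r" "smooth_retract W' M' r'" "x \<in> M" "x' \<in> M'"
  shows "tangent_space (M \<times> M') (x, x') = tangent_space M x \<times> tangent_space M' x'"
proof -
  interpret S: smooth_retract W M r by fact
  interpret S': smooth_retract W' M' r' by fact
  have "(r has_derivative S.P x) (at (fst (x, x')))" "(r' has_derivative S'.P x') (at (snd (x, x')))"
    using S.P[OF S.in_W[OF assms(3)]] S'.P[OF S'.in_W[OF assms(4)]] by simp_all
  then have "((\<lambda>z. (r (fst z), r' (snd z))) has_derivative (\<lambda>v. (S.P x (fst v), S'.P x' (snd v)))) (at (x, x'))"
    by (rule has_derivative_Pair[OF has_derivative_compose[OF has_derivative_fst[OF has_derivative_ident]]
        has_derivative_compose[OF has_derivative_snd[OF has_derivative_ident]]])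
  from smooth_retract_tangent_space[OF smooth_retract_Times[OF assms(1,2)] _ this] show ?thesis
    using assms(3,4) by (auto simp: S.tangent_space_eq S'.tangent_space_eq)
qed

lemma tangent_space_prices: "p \<in> prices n \<Longrightarrow> tangent_space (prices n) p = reduced_space n"
  using smooth_retract_tangent_space[OF smooth_retract_prices _ normalize_price_has_derivative]
  by (simp add: drop_coord_eq_iff)

lemma tangent_space_open: "open U \<Longrightarrow> x \<in> U \<Longrightarrow> tangent_space U x = UNIV"
  using smooth_retract_tangent_space[OF smooth_retract_open _ has_derivative_ident] by simp

lemma tangent_space_reduced_space: "y \<in> reduced_space n \<Longrightarrow> tangent_space (reduced_space n) y = reduced_space n"
  using smooth_retract_tangent_space[OF smooth_retract_reduced_space _ linear_imp_has_derivative[OF linear_drop_coord]]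
  by (simp add: drop_coord_eq_iff)

lemma tangent_space_prices_endowments:
  assumes "x \<in> prices n \<times> endowments"
  shows "tangent_space (prices n \<times> endowments) x = reduced_space n \<times> UNIV"
proof -
  obtain q w where x: "x = (q, w)" "q \<in> prices n" "w \<in> endowments" using assms by auto
  show ?thesis
    unfolding x(1) tangent_space_Times[OF smooth_retract_prices smooth_retract_open[OF open_endowments] x(2,3)]
    by (simp only: tangent_space_prices[OF x(2)] tangent_space_open[OF open_endowments x(3)])
qed

lemma tangent_space_endowments_reduced:
  assumes "x \<in> endowments \<times> reduced_space n"
  shows "tangent_space (endowments \<times> reduced_space n) x = UNIV \<times> reduced_space n"
proof -
  obtain w y where x: "x = (w, y)" "w \<in> endowments" "y \<in> reduced_space n" using assms by auto
  show ?thesis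
    unfolding x(1) tangent_space_Times[OF smooth_retract_open[OF open_endowments] smooth_retract_reduced_space x(2,3)]
    by (simp only: tangent_space_reduced_space[OF x(3)] tangent_space_open[OF open_endowments x(2)])
qed

text \<open>Walras' law recovers the deleted coordinate: when all others vanish, the value of the
  bundle is this coordinate times the numeraire price 1.\<close>

lemma drop_coord_eq_0:
  assumes "drop_coord n y = 0" "p $ n = 1" "p \<bullet> y = 0"
  shows "y = 0"
proof -
  have y: "y $ k = 0" if "k \<noteq> n" for k
    using assms(1)[THEN arg_cong, of "\<lambda>z. z $ k"] that by (simp add: drop_coord_def)
  have "p \<bullet> y = p $ n * y $ n"
    unfolding inner_vec_def using y by (subst sum.remove[of _ n]) (auto intro!: sum.neutral)
  then have "y $ n = 0" using assms by simp
  then show ?thesis using y by (metis vec_eq_iff zero_index)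
qed

section \<open>The equilibrium manifold\<close>

locale exchange_economy =
  fixes u :: "'m::finite \<Rightarrow> real ^ 'l::finite \<Rightarrow> real" and n :: 'l
  assumes utility_function: "utility_function (u i)"
begin

lemma utility: "utility (u i)" by unfold_locales (rule utility_function)

lemmas Ck_h = utility_numeraire.Ck_h[unfolded utility_numeraire_def, OF utility]
  and demand_eq = utility_numeraire.demand_eq[unfolded utility_numeraire_def, OF utility]
  and walras = utility_numeraire.walras[unfolded utility_numeraire_def, OF utility]

abbreviation E :: "((real ^ 'l) \<times> (real ^ 'l ^ 'm)) set" where "E \<equiv> equilibrium_manifold u n"

definition D :: "((real ^ 'l) \<times> (real ^ 'l ^ 'm)) set" where "D = goods_space \<times> endowments"

definition slot :: "real ^ 'l \<Rightarrow> real ^ 'l \<Rightarrow> real ^ 'l" where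
  "slot p w = (\<chi> k. if k = n then p \<bullet> w else p $ k)"

text \<open>Written with \<open>h\<close>, excess demand extends smoothly to all positive prices;
  its tie to \<open>demand\<close> and Walras' law are established for normalized prices
  only.\<close>

definition Z :: "(real ^ 'l) \<times> (real ^ 'l ^ 'm) \<Rightarrow> real ^ 'l" where
  "Z x = (\<Sum>i\<in>UNIV. utility_numeraire.h (u i) n (slot (fst x) (snd x $ i)) - snd x $ i)"

definition Zr :: "(real ^ 'l) \<times> (real ^ 'l ^ 'm) \<Rightarrow> real ^ 'l" where "Zr x = drop_coord n (Z x)"

abbreviation DZ where "DZ x \<equiv> frechet_derivative Z (at x)"
abbreviation DZr where "DZr x \<equiv> frechet_derivative Zr (at x)"

lemma open_D: "open D" unfolding D_def by (intro open_Times open_goods_space open_endowments)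

lemma in_D: "x \<in> prices n \<times> endowments \<Longrightarrow> x \<in> D"
  by (auto simp: D_def prices_goods)

lemma Ck_Z: "Ck_on k D Z"
  unfolding Z_def
proof (intro Ck_on_sum open_D Ck_on_diff)
  fix i
  have s: "Ck_on k D (\<lambda>x. snd x $ i)"
    by (intro Ck_on_vec_nth open_D Ck_on_linear linear_snd)
  have f: "Ck_on k D (\<lambda>x. fst x)" by (intro open_D Ck_on_linear linear_fst)
  have "Ck_on k D (\<lambda>x. slot (fst x) (snd x $ i))"
  proof (rule Ck_on_vec[OF open_D])
    fix j show "Ck_on k D (\<lambda>x. slot (fst x) (snd x $ i) $ j)"
      by (cases "j = n") (auto simp: slot_def intro!: Ck_on_inner open_D s f Ck_on_vec_nth)
  qed
  moreover have "(\<lambda>x. slot (fst x) (snd x $ i)) ` D \<subseteq> goods_space"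
    by (auto simp: D_def slot_def endowments_def goods_space_def
        intro!: inner_goods_space_pos[unfolded goods_space_def])
  ultimately show "Ck_on k D (\<lambda>x. utility_numeraire.h (u i) n (slot (fst x) (snd x $ i)))"
    by (rule Ck_on_compose[OF open_D _ Ck_h])
  show "Ck_on k D (\<lambda>x. snd x $ i)" by (rule s)
qed

lemma Ck_Zr: "Ck_on k D Zr"
  unfolding Zr_def
  by (rule Ck_on_bounded_linear[OF linear_conv_bounded_linear[THEN iffD1, OF linear_drop_coord] open_D Ck_Z])

lemma DZ: "x \<in> D \<Longrightarrow> (Z has_derivative DZ x) (at x)"
  by (rule Ck_on_has_derivative[OF Ck_Z])

lemma DZr: "x \<in> D \<Longrightarrow> (Zr has_derivative DZr x) (at x)"
  by (rule Ck_on_has_derivative[OF Ck_Zr])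

lemma linear_DZr: "x \<in> D \<Longrightarrow> linear (DZr x)"
  using DZr has_derivative_linear by blast

lemma DZr_eq:
  assumes "x \<in> D" shows "DZr x a = drop_coord n (DZ x a)"
proof -
  have "(Zr has_derivative (\<lambda>a. drop_coord n (DZ x a))) (at x)"
    unfolding Zr_def
    by (rule bounded_linear.has_derivative[OF linear_conv_bounded_linear[THEN iffD1, OF linear_drop_coord] DZ[OF assms]])
  from frechet_derivative_at[OF this] show ?thesis by (rule fun_cong[symmetric])
qed

lemma DZr_in: "x \<in> D \<Longrightarrow> DZr x a \<in> reduced_space n"
  by (simp add: DZr_eq drop_coord_in)

lemma excess_demand_eq:
  assumes "p \<in> prices n" "\<omega> \<in> endowments"
  shows "excess_demand u p \<omega> = Z (p, \<omega>)"
  using assms by (auto simp: excess_demand_def Z_def slot_def demand_eq endowments_def)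

lemma reduced_excess_demand_eq:
  assumes "p \<in> prices n" "\<omega> \<in> endowments"
  shows "reduced_excess_demand u n \<omega> p = Zr (p, \<omega>)"
  by (simp add: reduced_excess_demand_def excess_demand_eq[OF assms] Zr_def drop_coord_def
      vec_eq_iff)

lemma price_inner_Z:
  assumes "x \<in> prices n \<times> endowments" shows "fst x \<bullet> Z x = 0"
  using assms
  by (auto simp: Z_def inner_sum_right inner_diff_right slot_def walras endowments_def cong: if_cong)

lemma E_eq: "E = {x \<in> prices n \<times> endowments. Z x = 0}"
  by (auto simp: equilibrium_manifold_def excess_demand_eq)

lemma E_sub: "x \<in> E \<Longrightarrow> x \<in> prices n \<times> endowments" "x \<in> E \<Longrightarrow> x \<in> D" "x \<in> E \<Longrightarrow> Z x = 0"
  using in_D by (auto simp: E_eq)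

text \<open>Trading along the budget hyperplane does not change demand.\<close>

lemma Z_trade:
  assumes "fst x \<bullet> k = 0"
  shows "Z (fst x, snd x + axis i k) = Z x - k"
proof -
  have "slot (fst x) ((snd x + axis i k) $ j) = slot (fst x) (snd x $ j)" for j
    using assms by (simp add: slot_def axis_def inner_add_right cong: if_cong)
  moreover have "(\<Sum>j\<in>UNIV. axis i k $ j) = k" by (simp add: axis_def)
  ultimately show ?thesis
    by (simp add: Z_def sum_subtractf sum.distrib)
qed

text \<open>\<open>Z_trade\<close> is affine in the traded bundle, so it can be differentiated along
  the multiples of \<open>k\<close>.\<close>

lemma DZ_trade:
  assumes x: "x \<in> D" and k: "fst x \<bullet> k = 0"
  shows "DZ x (0, axis i k) = - k"
proof -
  have ax: "axis i (t *\<^sub>R k) = t *\<^sub>R axis i k" for t :: real by (simp add: axis_def vec_eq_iff)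
  have line: "((\<lambda>t. x + t *\<^sub>R (0, axis i k)) has_vector_derivative (0, axis i k)) (at (0::real))"
    by (auto intro!: derivative_eq_intros)
  from has_vector_derivative_compose[OF this, of Z "DZ x"] DZ[OF x]
  have "((\<lambda>t. Z (x + t *\<^sub>R (0, axis i k))) has_vector_derivative DZ x (0, axis i k)) (at 0)"
    by (simp flip: zero_prod_def)
  moreover have "Z (x + t *\<^sub>R (0, axis i k)) = Z x - t *\<^sub>R k" for t
    using Z_trade[of x "t *\<^sub>R k" i] k by (simp add: ax plus_prod_def)
  moreover have "((\<lambda>t. Z x - t *\<^sub>R k) has_vector_derivative - k) (at (0::real))"
    by (auto intro!: derivative_eq_intros)
  ultimately show ?thesis using vector_derivative_unique_at by simp blast
qed

lemma DZr_surj: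
  assumes x: "x \<in> prices n \<times> endowments" and b: "b \<in> reduced_space n"
  shows "\<exists>h. DZr x (0, h) = b"
proof -
  \<comment> \<open>The trade \<open>- b\<close> with its numeraire coordinate adjusted so that it
    costs nothing; deleting that coordinate afterwards recovers \<open>b\<close>.\<close>
  define k where "k = (fst x \<bullet> b) *\<^sub>R axis n 1 - b"
  have "fst x $ n = 1" using x by (auto simp: prices_goods)
  then have "fst x \<bullet> k = 0" by (simp add: k_def inner_diff_right inner_axis)
  \<comment> \<open>\<open>undefined\<close> names an arbitrary consumer; any of them can make the
    trade.\<close>
  then have "DZr x (0, axis undefined k) = drop_coord n (- k)"
    by (simp add: DZr_eq DZ_trade in_D[OF x])
  also have "\<dots> = b"
    using b by (auto simp: drop_coord_def k_def reduced_space_def vec_eq_iff axis_def)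
  finally show ?thesis by blast
qed

text \<open>Walras' law, available on normalized prices, is differentiated within that set; at an
  equilibrium the term carrying \<open>Z x\<close> drops out.\<close>

lemma price_inner_DZ:
  assumes x: "x \<in> E" and a: "a \<in> reduced_space n \<times> UNIV"
  shows "fst x \<bullet> DZ x a = 0"
proof -
  note xS = E_sub(1)[OF x]
  have aT: "a \<in> tangent_space (prices n \<times> endowments) x"
    using a by (simp add: tangent_space_prices_endowments[OF xS])
  have "((\<lambda>x. fst x \<bullet> Z x) has_derivative (\<lambda>a. fst x \<bullet> DZ x a + fst a \<bullet> Z x)) (at x)"
    by (intro has_derivative_inner DZ E_sub(2)[OF x] has_derivative_fst has_derivative_ident)
  then have "((\<lambda>x. fst x \<bullet> Z x) has_derivative (\<lambda>a. fst x \<bullet> DZ x a + fst a \<bullet> Z x))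
      (at x within prices n \<times> endowments)"
    by (rule has_derivative_at_withinI)
  from differential_eq[OF this aT]
  have "differential (prices n \<times> endowments) (\<lambda>x. fst x \<bullet> Z x) x a = fst x \<bullet> DZ x a"
    by (simp add: E_sub(3)[OF x])
  moreover have "((\<lambda>x. fst x \<bullet> Z x) has_derivative (\<lambda>a. 0)) (at x within prices n \<times> endowments)"
    by (rule has_derivative_transform[OF xS _ has_derivative_const[of 0]]) (rule price_inner_Z)
  from differential_eq[OF this aT]
  have "differential (prices n \<times> endowments) (\<lambda>x. fst x \<bullet> Z x) x a = 0" .
  ultimately show ?thesis by simp
qed

text \<open>Handing the excess demand to one consumer leaves all incomes unchanged and clears the markets.
  This retracts a neighbourhood onto the equilibrium manifold.\<close>

definition clear :: "(real ^ 'l) \<times> (real ^ 'l ^ 'm) \<Rightarrow> (real ^ 'l) \<times> (real ^ 'l ^ 'm)" where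
  "clear x = (let x' = (normalize_price n (fst x), snd x) in (fst x', snd x' + axis undefined (Z x')))"

lemma linear_axis: "linear (axis i :: real ^ 'l \<Rightarrow> real ^ 'l ^ 'm)"
  by (rule linearI) (auto simp: vec_eq_iff axis_def)

lemma normalize_in_D: "x \<in> D \<Longrightarrow> (normalize_price n (fst x), snd x) \<in> prices n \<times> endowments"
  by (auto simp: D_def normalize_price_in)

lemma Ck_clear: "Ck_on k D clear"
proof -
  have f: "Ck_on k D (\<lambda>x. normalize_price n (fst x))"
    by (rule Ck_on_compose[OF open_D Ck_on_linear[OF open_D linear_fst] Ck_normalize_price[of UNIV]]) auto
  have s: "Ck_on k D snd" by (intro open_D Ck_on_linear linear_snd)
  have "Ck_on k D (\<lambda>x. Z (normalize_price n (fst x), snd x))"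
    by (rule Ck_on_compose[OF open_D Ck_on_Pair[OF open_D f s] Ck_Z]) (use normalize_in_D in_D in blast)
  then show ?thesis
    unfolding clear_def Let_def fst_conv snd_conv
    by (intro Ck_on_Pair Ck_on_add open_D f s
      Ck_on_bounded_linear[OF linear_conv_bounded_linear[THEN iffD1, OF linear_axis]])
qed

text \<open>A negative excess demand could use up the endowment of the consumer who receives it; the
  preimage condition in the domain keeps the corrected endowments positive.\<close>

lemma smooth_retract_E: "smooth_retract (D \<inter> clear -` (UNIV \<times> endowments)) E clear"
proof
  show op: "open (D \<inter> clear -` (UNIV \<times> endowments))"
    by (rule continuous_open_preimage[OF Ck_on_imp_continuous_on[OF Ck_clear] open_D])
      (intro open_Times open_endowments open_UNIV)
  show "clear x = x" if "x \<in> E" for x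
  proof -
    have "(normalize_price n (fst x), snd x) = x"
      using E_sub(1)[OF that] by (auto simp: normalize_price_eq prices_goods)
    then show ?thesis using E_sub(3)[OF that] by (simp add: clear_def linear_0[OF linear_axis] prod_eq_iff)
  qed
  then show "E \<subseteq> D \<inter> clear -` (UNIV \<times> endowments)" using E_sub by auto
  show "Ck_on k (D \<inter> clear -` (UNIV \<times> endowments)) clear" for k
    by (rule Ck_on_subset[OF Ck_clear]) auto
  fix x assume x: "x \<in> D \<inter> clear -` (UNIV \<times> endowments)"
  define x' where "x' = (normalize_price n (fst x), snd x)"
  have x': "x' \<in> prices n \<times> endowments" unfolding x'_def using normalize_in_D x by blast
  have "clear x = (fst x', snd x' + axis undefined (Z x'))" by (simp add: clear_def x'_def)
  \<comment> \<open>By Walras' law the bundle handed over costs nothing, so demand does not react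
    and the excess becomes \<open>Z x' - Z x'\<close>.\<close>
  moreover then have "Z (clear x) = 0" using Z_trade[OF price_inner_Z[OF x']] by simp
  ultimately show "clear x \<in> E" using x x' by (auto simp: E_eq)
qed

sublocale E: smooth_retract "D \<inter> clear -` (UNIV \<times> endowments)" E clear
  by (rule smooth_retract_E)

text \<open>The vectors fixed by the derivative of \<open>clear\<close> are those with reduced price
  part in the kernel of the full \<open>DZ x\<close>; the differentiated Walras law replaces this by
  the kernel of the reduced derivative.\<close>

lemma tangent_space_E:
  assumes x: "x \<in> E"
  shows "tangent_space E x = {a \<in> reduced_space n \<times> UNIV. DZr x a = 0}"
proof -
  let ?N = "\<lambda>x :: (real ^ 'l) \<times> (real ^ 'l ^ 'm). (normalize_price n (fst x), snd x)"
  let ?N' = "\<lambda>a :: (real ^ 'l) \<times> (real ^ 'l ^ 'm). (drop_coord n (fst a), snd a)"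
  have Nx: "?N x = x" using E_sub(1)[OF x] by (auto simp: normalize_price_eq prices_goods)
  have N: "(?N has_derivative ?N') (at x)"
    by (rule has_derivative_Pair[OF
        has_derivative_compose[OF has_derivative_fst[OF has_derivative_ident] normalize_price_has_derivative]
        has_derivative_snd[OF has_derivative_ident]])
  have "((\<lambda>x. Z (?N x)) has_derivative (\<lambda>a. DZ x (?N' a))) (at x)"
    using has_derivative_compose[OF N, of Z "DZ x"] DZ[OF E_sub(2)[OF x]] by (simp only: Nx)
  then have "((\<lambda>x. (normalize_price n (fst x), snd x + axis undefined (Z (?N x)))) has_derivative
      (\<lambda>a. (drop_coord n (fst a), snd a + axis undefined (DZ x (?N' a))))) (at x)"
    by (rule has_derivative_Pair[OF
        has_derivative_compose[OF has_derivative_fst[OF has_derivative_ident] normalize_price_has_derivative]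
        has_derivative_add[OF has_derivative_snd[OF has_derivative_ident]
          bounded_linear.has_derivative[OF linear_conv_bounded_linear[THEN iffD1, OF linear_axis]]]])
  then have "(clear has_derivative
      (\<lambda>a. (drop_coord n (fst a), snd a + axis undefined (DZ x (?N' a))))) (at x)"
    unfolding clear_def Let_def fst_conv snd_conv .
  from smooth_retract_tangent_space[OF smooth_retract_E x this]
  have T: "tangent_space E x = {a. drop_coord n (fst a) = fst a \<and> axis undefined (DZ x (?N' a)) = (0 :: real ^ 'l ^ 'm)}"
    by (auto simp: prod_eq_iff)
  have "axis undefined y = (0 :: real ^ 'l ^ 'm) \<longleftrightarrow> y = 0" for y :: "real ^ 'l"
    by (metis axis_eq_0_iff)
  moreover have "DZ x a = 0 \<longleftrightarrow> DZr x a = 0" if "a \<in> reduced_space n \<times> UNIV" for a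
    using DZr_eq[OF E_sub(2)[OF x]] linear_0[OF linear_drop_coord]
      drop_coord_eq_0[OF _ _ price_inner_DZ[OF x that]] E_sub(1)[OF x] prices_goods(2)
    by (metis mem_Times_iff)
  moreover have "drop_coord n (fst a) = fst a \<longleftrightarrow> a \<in> reduced_space n \<times> UNIV"
    for a :: "(real ^ 'l) \<times> (real ^ 'l ^ 'm)"
    by (simp add: drop_coord_eq_iff mem_Times_iff)
  moreover have "?N' a = a" if "drop_coord n (fst a) = fst a" for a using that by simp
  ultimately show ?thesis unfolding T by (intro Collect_cong) metis
qed

lemma differential_projection:
  assumes "a \<in> tangent_space E x"
  shows "differential E natural_projection x a = snd a"
  unfolding natural_projection_def
  by (rule differential_eq[OF has_derivative_snd[OF has_derivative_ident] assms])

lemma differential_reduced_excess_demand: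
  assumes q: "q \<in> prices n" and \<omega>: "\<omega> \<in> endowments" and a: "a \<in> reduced_space n"
  shows "differential (prices n) (reduced_excess_demand u n \<omega>) q a = DZr (q, \<omega>) (a, 0)"
proof -
  have d: "((\<lambda>q. Zr (q, \<omega>)) has_derivative (\<lambda>a. DZr (q, \<omega>) (a, 0))) (at q within prices n)"
    using has_derivative_compose[OF has_derivative_Pair[OF has_derivative_ident has_derivative_const]
        DZr[OF in_D]] q \<omega> by blast
  have "(reduced_excess_demand u n \<omega> has_derivative (\<lambda>a. DZr (q, \<omega>) (a, 0))) (at q within prices n)"
    by (rule has_derivative_transform[OF q _ d]) (rule reduced_excess_demand_eq[OF _ \<omega>])
  then show ?thesis
    by (rule differential_eq) (simp add: tangent_space_prices[OF q] a)
qed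

lemma differential_graph_map:
  assumes x: "x \<in> prices n \<times> endowments" and a: "a \<in> reduced_space n \<times> UNIV"
  shows "differential (prices n \<times> endowments) (graph_map u n) x a = (snd a, DZr x a)"
proof -
  have "((\<lambda>x. (snd x, Zr x)) has_derivative (\<lambda>a. (snd a, DZr x a))) (at x within prices n \<times> endowments)"
    by (rule has_derivative_at_withinI[OF has_derivative_Pair[OF
        has_derivative_snd[OF has_derivative_ident] DZr[OF in_D[OF x]]]])
  then have "(graph_map u n has_derivative (\<lambda>a. (snd a, DZr x a))) (at x within prices n \<times> endowments)"
    by (rule has_derivative_transform[OF x, rotated]) (auto simp: graph_map_def reduced_excess_demand_eq)
  then show ?thesis
    by (rule differential_eq) (simp add: tangent_space_prices_endowments[OF x] a)
qed

end

section \<open>Kernels, cokernels and second derivatives at an equilibrium\<close>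

locale equilibrium = exchange_economy u n for u :: "'m::finite \<Rightarrow> real ^ 'l::finite \<Rightarrow> real" and n +
  fixes p :: "real ^ 'l" and \<omega> :: "real ^ 'l ^ 'm"
  assumes eq: "(p, \<omega>) \<in> equilibrium_manifold u n"
begin

abbreviation "e \<equiv> (p, \<omega>)"
abbreviation "R \<equiv> reduced_space n :: (real ^ 'l) set"
abbreviation "z \<equiv> reduced_excess_demand u n \<omega>"
abbreviation "\<pi> \<equiv> natural_projection :: (real ^ 'l) \<times> (real ^ 'l ^ 'm) \<Rightarrow> real ^ 'l ^ 'm"
abbreviation "T \<equiv> tangent_space E e"
abbreviation "A \<equiv> DZr e"

lemma e: "p \<in> prices n" "\<omega> \<in> endowments" "e \<in> prices n \<times> endowments" "e \<in> D"
  using E_sub[OF eq] by auto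

interpretation A: linear A by (rule linear_DZr[OF e(4)])

lemma A_split: "A (v, h) = A (v, 0) + A (0, h)"
  using A.add[of "(v, 0)" "(0, h)"] by simp

lemmas A_surj = DZr_surj[OF e(3)]
  and A_in = DZr_in[OF e(4)]
  and T_eq = tangent_space_E[OF eq]
  and T_prices = tangent_space_prices[OF e(1)]
  and T_endowments = tangent_space_open[OF open_endowments e(2)]
  and T_prod = tangent_space_prices_endowments[OF e(3)]

lemma z_in: "q \<in> prices n \<Longrightarrow> z q \<in> R"
  by (simp add: reduced_excess_demand_def reduced_space_def)

lemma T_reduced: "q \<in> prices n \<Longrightarrow> tangent_space R (z q) = R"
  by (rule tangent_space_reduced_space[OF z_in])

lemma dz: "a \<in> R \<Longrightarrow> differential (prices n) z p a = A (a, 0)"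
  by (rule differential_reduced_excess_demand[OF e(1,2)])

lemma Ker_z: "Ker (prices n) z p = {a \<in> R. A (a, 0) = 0}"
  unfolding Ker_def ker_on_def T_prices using dz by auto

lemma Ker_projection: "Ker E \<pi> e = (\<lambda>v. (v, 0)) ` Ker (prices n) z p"
  unfolding Ker_z unfolding Ker_def ker_on_def
  using differential_projection[of _ e] by (auto simp: T_eq)

lemma Img_z: "Img (prices n) z p = (\<lambda>a. A (a, 0)) ` R"
  unfolding Img_def T_prices by (rule image_cong[OF refl dz])

lemma Img_projection: "Img E \<pi> e = snd ` T"
  unfolding Img_def by (rule image_cong[OF refl differential_projection])

lemma Img_graph: "Img (prices n \<times> endowments) (graph_map u n) e = (\<lambda>a. (snd a, A a)) ` (R \<times> UNIV)"
  unfolding Img_def T_prod by (rule image_cong[OF refl differential_graph_map[OF e(3)]])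

lemma mem_Img_projection: "h \<in> Img E \<pi> e \<longleftrightarrow> (\<exists>v\<in>R. A (v, h) = 0)"
  unfolding Img_projection T_eq by force

lemma mem_Img_graph:
  "(h, b) \<in> Img (prices n \<times> endowments) (graph_map u n) e \<longleftrightarrow> (\<exists>v\<in>R. A (v, h) = b)"
  unfolding Img_graph by force

lemma linear_A_fst: "linear (\<lambda>a. A (a, 0))"
  by (rule linearI) (simp_all add: A.add[symmetric] A.scale[symmetric])

lemma subspaces:
  "subspace (Img (prices n) z p)"
  "subspace (Img E \<pi> e)"
  "subspace (Img (prices n \<times> endowments) (graph_map u n) e)"
  unfolding Img_z Img_projection Img_graph
proof -
  show "subspace ((\<lambda>a. A (a, 0)) ` R)"
    by (rule linear_subspace_image[OF linear_A_fst subspace_reduced_space])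
  show "subspace (snd ` T)"
    by (rule linear_subspace_image[OF linear_snd E.subspace_tangent_space[OF eq]])
  show "subspace ((\<lambda>a. (snd a, A a)) ` (R \<times> UNIV))"
    by (rule linear_subspace_image[OF _ subspace_Times[OF subspace_reduced_space subspace_UNIV]])
      (rule linearI; simp add: A.add A.scale)
qed

lemma Coker_eq:
  "Coker (prices n) R z p = (\<lambda>w. w +o Img (prices n) z p) ` R"
  "Coker E endowments \<pi> e = (\<lambda>w. w +o Img E \<pi> e) ` UNIV"
  "Coker (prices n \<times> endowments) (endowments \<times> R) (graph_map u n) e =
    (\<lambda>w. w +o Img (prices n \<times> endowments) (graph_map u n) e) ` (UNIV \<times> R)"
proof -
  show "Coker (prices n) R z p = (\<lambda>w. w +o Img (prices n) z p) ` R"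
    unfolding Coker_def coker_on_def Img_def T_reduced[OF e(1)] ..
  show "Coker E endowments \<pi> e = (\<lambda>w. w +o Img E \<pi> e) ` UNIV"
    unfolding Coker_def coker_on_def Img_def by (simp add: natural_projection_def T_endowments)
  have "tangent_space (endowments \<times> R) (graph_map u n e) = UNIV \<times> R"
    by (rule tangent_space_endowments_reduced) (simp add: graph_map_def e z_in)
  then show "Coker (prices n \<times> endowments) (endowments \<times> R) (graph_map u n) e =
    (\<lambda>w. w +o Img (prices n \<times> endowments) (graph_map u n) e) ` (UNIV \<times> R)"
    unfolding Coker_def coker_on_def Img_def by simp
qed

lemma linear_inclusions:
  "linear (\<lambda>a :: real ^ 'l ^ 'm. (a, 0 :: real ^ 'l))" "linear (\<lambda>b :: real ^ 'l. (0 :: real ^ 'l ^ 'm, b))"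
  by (auto intro: linearI)

text \<open>A vector \<open>(h, 0)\<close> in the image of the derivative of
  \<open>graph_map\<close> comes from a tangent vector of \<open>E\<close>, which gives injectivity.
  For surjectivity an endowment direction with the right value of \<open>A\<close> removes the
  second component.\<close>

lemma j1_iso:
  "quotient_iso (Img E \<pi> e) (Coker E endowments \<pi> e)
     (Img (prices n \<times> endowments) (graph_map u n) e)
     (Coker (prices n \<times> endowments) (endowments \<times> R) (graph_map u n) e) (j1 u n e)"
  unfolding Coker_eq j1_def
proof (rule quotient_iso_induced_map[OF subspaces(2,3) subspace_UNIV linear_inclusions(1)])
  show "(h, 0) \<in> UNIV \<times> R" for h :: "real ^ 'l ^ 'm" by (simp add: subspace_0[OF subspace_reduced_space])
  show "(h, 0) \<in> Img (prices n \<times> endowments) (graph_map u n) e \<longleftrightarrow> h \<in> Img E \<pi> e" for h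
    by (simp add: mem_Img_projection mem_Img_graph)
  fix w' :: "(real ^ 'l ^ 'm) \<times> (real ^ 'l)" assume w': "w' \<in> UNIV \<times> R"
  then obtain h where "A (0, h) = snd w'" using A_surj[of "snd w'"] by auto
  then have "(h, snd w') \<in> Img (prices n \<times> endowments) (graph_map u n) e"
    unfolding mem_Img_graph using subspace_0[OF subspace_reduced_space] by blast
  moreover have "w' - (fst w' - h, 0) = (h, snd w')" by (simp add: prod_eq_iff)
  ultimately show "\<exists>w\<in>UNIV. w' - (w, 0) \<in> Img (prices n \<times> endowments) (graph_map u n) e"
    by (metis UNIV_I)
qed simp

text \<open>A pure endowment direction \<open>h\<close> is sent to \<open>(h, A (0, h))\<close>, so
  modulo the image the first component can always be moved into the second.\<close>

lemma j2_iso: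
  "quotient_iso (Img (prices n) z p) (Coker (prices n) R z p)
     (Img (prices n \<times> endowments) (graph_map u n) e)
     (Coker (prices n \<times> endowments) (endowments \<times> R) (graph_map u n) e) (j2 u n e)"
  unfolding Coker_eq j2_def
proof (rule quotient_iso_induced_map[OF subspaces(1,3) subspace_reduced_space linear_inclusions(2)])
  show "Img (prices n) z p \<subseteq> R" unfolding Img_z using A_in by auto
  show "(0, b) \<in> Img (prices n \<times> endowments) (graph_map u n) e \<longleftrightarrow> b \<in> Img (prices n) z p" for b
    unfolding mem_Img_graph Img_z by auto
  fix w' :: "(real ^ 'l ^ 'm) \<times> (real ^ 'l)" assume w': "w' \<in> UNIV \<times> R"
  have "(fst w', A (0, fst w')) \<in> Img (prices n \<times> endowments) (graph_map u n) e"
    unfolding mem_Img_graph using subspace_0[OF subspace_reduced_space] by blast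
  moreover have "w' - (0, snd w' - A (0, fst w')) = (fst w', A (0, fst w'))" by (simp add: prod_eq_iff)
  moreover have "snd w' - A (0, fst w') \<in> R"
    using w' subspace_diff[OF subspace_reduced_space _ A_in] by auto
  ultimately show "\<exists>w\<in>R. w' - (0, w) \<in> Img (prices n \<times> endowments) (graph_map u n) e"
    by metis
qed simp

lemma canonical_iso:
  "quotient_iso (Img (prices n) z p) (Coker (prices n) R z p) (Img E \<pi> e) (Coker E endowments \<pi> e)
     (canonical_map u n e)"
  unfolding canonical_map_def
  by (rule quotient_iso_inv_into_comp[OF subspaces(2) subspace_UNIV Coker_eq(2) j1_iso j2_iso])

text \<open>\<open>(h, - b)\<close> is the image of the pure endowment direction \<open>h\<close>,
  so \<open>(h, 0)\<close> and \<open>(0, b)\<close> have the same class. This makes the inverse of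
  \<open>j1\<close> explicit.\<close>

lemma canonical_map_coset:
  assumes b: "b \<in> R" and h: "A (0, h) = - b"
  shows "canonical_map u n e (b +o Img (prices n) z p) = h +o Img E \<pi> e"
proof -
  let ?K = "Img (prices n \<times> endowments) (graph_map u n) e"
  have "(h, - b) \<in> ?K"
    unfolding mem_Img_graph using h subspace_0[OF subspace_reduced_space] by blast
  then have "(h, 0) +o ?K = (0, b) +o ?K" by (simp add: coset_eq_iff[OF subspaces(3)])
  moreover have "j1 u n e (h +o Img E \<pi> e) = (h, 0) +o ?K"
    unfolding j1_def
    by (rule induced_map_coset[OF linear_inclusions(1) subspaces(2,3)])
      (auto simp: mem_Img_projection mem_Img_graph)
  moreover have "j2 u n e (b +o Img (prices n) z p) = (0, b) +o ?K"
    unfolding j2_def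
    by (rule induced_map_coset[OF linear_inclusions(2) subspaces(1,3)])
      (auto simp: Img_z mem_Img_graph)
  ultimately have "j2 u n e (b +o Img (prices n) z p) = j1 u n e (h +o Img E \<pi> e)" by simp
  moreover have "h +o Img E \<pi> e \<in> Coker E endowments \<pi> e" unfolding Coker_eq by blast
  moreover have "inj_on (j1 u n e) (Coker E endowments \<pi> e)"
    using j1_iso unfolding quotient_iso_def bij_betw_def by blast
  ultimately show ?thesis unfolding canonical_map_def by simp
qed

text \<open>Injectivity and surjectivity are matched separately. A tangent vector of
  \<open>E\<close> without endowment part is a kernel vector of \<open>A\<close> in price
  directions; for the ranges, \<open>A (v, h) = 0\<close> balances an endowment part against a price
  part, and \<open>A (0, h)\<close> takes every value in \<open>R\<close>.\<close>

lemma critical_iff: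
  "critical_point E endowments \<pi> e \<longleftrightarrow> critical_point (prices n) R z p"
proof -
  have inj0: "inj_on f S \<longleftrightarrow> (\<forall>a\<in>S. f a = 0 \<longrightarrow> a = 0)"
    if "linear f" "subspace S" for f :: "'x::real_vector \<Rightarrow> 'y::real_vector" and S
    using linear_inj_on_iff_eq_0[of f S] linear_injective_on_subspace_0[OF that] by blast
  have "bij_betw (differential E \<pi> e) T UNIV \<longleftrightarrow> bij_betw snd T UNIV"
    by (rule bij_betw_cong) (rule differential_projection)
  moreover have "bij_betw (differential (prices n) z p) R R \<longleftrightarrow> bij_betw (\<lambda>a. A (a, 0)) R R"
    by (rule bij_betw_cong) (rule dz)
  moreover have "inj_on snd T \<longleftrightarrow> inj_on (\<lambda>a. A (a, 0)) R"
    unfolding inj0[OF linear_snd E.subspace_tangent_space[OF eq]] inj0[OF linear_A_fst subspace_reduced_space]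
    unfolding T_eq by (auto simp: zero_prod_def)
  moreover have "snd ` T = UNIV \<longleftrightarrow> (\<lambda>a. A (a, 0)) ` R = R"
  proof
    assume s: "snd ` T = UNIV"
    show "(\<lambda>a. A (a, 0)) ` R = R"
    proof (intro equalityI subsetI)
      fix b assume b: "b \<in> R"
      then obtain h where h: "A (0, h) = - b"
        using A_surj[of "- b"] subspace_neg[OF subspace_reduced_space] by blast
      obtain a where "a \<in> T" "snd a = h" using s by (metis UNIV_I imageE)
      then have "fst a \<in> R" "A (fst a, h) = 0" by (auto simp: T_eq)
      then have "fst a \<in> R" "A (fst a, 0) = b" using h A_split[of "fst a" h] by auto
      then show "b \<in> (\<lambda>a. A (a, 0)) ` R" by blast
    qed (use A_in in auto)
  next
    assume s: "(\<lambda>a. A (a, 0)) ` R = R"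
    have "h \<in> snd ` T" for h
    proof -
      have "- A (0, h) \<in> (\<lambda>a. A (a, 0)) ` R"
        unfolding s by (rule subspace_neg[OF subspace_reduced_space A_in])
      then obtain v where "v \<in> R" "A (v, 0) = - A (0, h)" by force
      then have "(v, h) \<in> T" using A_split[of v h] by (simp add: T_eq)
      then show ?thesis by force
    qed
    then show "snd ` T = UNIV" by blast
  qed
  ultimately show ?thesis
    unfolding critical_point_def T_prices T_reduced[OF e(1)] natural_projection_def snd_conv T_endowments
    unfolding natural_projection_def[symmetric] by (simp add: bij_betw_def)
qed

lemma second_derivatives:
  assumes v: "v \<in> Ker (prices n) z p" and w: "w \<in> Ker (prices n) z p"
  shows "intrinsic_second_derivative E endowments \<pi> e (v, 0) (w, 0) =
    canonical_map u n e (intrinsic_second_derivative (prices n) R z p v w)"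
proof -
  interpret S: smooth_retract goods_space "prices n" "normalize_price n"
    by (rule smooth_retract_prices)
  \<comment> \<open>The second derivative of the extended reduced excess demand in the price
    directions \<open>v\<close> and \<open>w\<close>; both intrinsic derivatives are expressed
    through it.\<close>
  define b where "b = frechet_derivative (\<lambda>y. DZr y (w, 0)) (at e) (v, 0)"
  have v': "v \<in> R" "A (v, 0) = 0" and w': "w \<in> R" "A (w, 0) = 0" using v w by (auto simp: Ker_z)
  \<comment> \<open>Coordinate \<open>n\<close> of \<open>DZr\<close> vanishes on the whole open set
    \<open>D\<close>, hence so does its derivative.\<close>
  have bR: "b \<in> R"
  proof -
    have "((\<lambda>y. DZr y (w, 0)) has_derivative frechet_derivative (\<lambda>y. DZr y (w, 0)) (at e)) (at e)"
      by (rule Ck_on_has_derivative[OF Ck_on_frechet_derivative[OF Ck_Zr] e(4)])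
    from bounded_linear.has_derivative[OF bounded_linear_vec_nth[of n] this]
    have "((\<lambda>y. DZr y (w, 0) $ n) has_derivative (\<lambda>v. frechet_derivative (\<lambda>y. DZr y (w, 0)) (at e) v $ n)) (at e)" .
    moreover have "((\<lambda>y. DZr y (w, 0) $ n) has_derivative (\<lambda>v. 0)) (at e)"
      by (rule has_derivative_transform_within_open[OF has_derivative_const[of 0] open_D e(4)])
        (use DZr_in in \<open>auto simp: reduced_space_def\<close>)
    ultimately have "frechet_derivative (\<lambda>y. DZr y (w, 0)) (at e) (v, 0) $ n = 0"
      by (metis has_derivative_unique)
    then show ?thesis by (simp add: b_def reduced_space_def)
  qed
  obtain h where h: "A (0, h) = - b"
    using A_surj[of "- b"] subspace_neg[OF subspace_reduced_space bR] by blast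
  \<comment> \<open>One product rule serves both sides: for price curves with fixed endowments and
    for curves in \<open>E\<close>.\<close>
  have b_deriv: "((\<lambda>t. DZr (y t) (c t)) has_vector_derivative b + A s) (at 0)"
    if "y 0 = e" "(y has_vector_derivative (v, 0)) (at (0::real))" "c 0 = (w, 0)"
      "(c has_vector_derivative s) (at 0)" for y c s
    using has_vector_derivative_frechet_apply[OF open_D Ck_Zr _ that(2,4)] that(1,3) e(4)
    by (simp add: b_def)
  have "intrinsic_second_derivative (prices n) R z p v w = b +o Img (prices n) z p"
    unfolding intrinsic_second_derivative_def
  proof (rule S.intrinsic_derivative_eqI[where G = R])
    show "p \<in> prices n" by (rule e)
    show "v \<in> tangent_space (prices n) p" "w \<in> tangent_space (prices n) p"
      using v' w' by (simp_all add: T_prices)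
    show "tangent_space R (z y) = R" if "y \<in> prices n" for y by (rule T_reduced[OF that])
    show "differential (prices n) z y b \<in> R" if "y \<in> prices n" "b \<in> tangent_space (prices n) y" for y b
      using that differential_reduced_excess_demand[OF that(1) e(2), of b] DZr_in in_D e(2)
      by (simp add: tangent_space_prices)
    show "differential (prices n) z p w = 0" using w' dz by simp
    fix y c s
    assume y: "\<forall>\<^sub>F t in nhds 0. y t \<in> prices n" "y 0 = p" "(y has_vector_derivative v) (at (0::real))"
      and c: "\<forall>\<^sub>F t in nhds 0. c t \<in> tangent_space (prices n) (y t)" "c 0 = w"
        "(c has_vector_derivative s) (at 0)"
    have "\<forall>\<^sub>F t in nhds 0. DZr (y t, \<omega>) (c t, 0) = differential (prices n) z (y t) (c t)"
      using y(1) c(1)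
      by eventually_elim (simp add: differential_reduced_excess_demand e(2) tangent_space_prices)
    moreover have "((\<lambda>t. DZr (y t, \<omega>) (c t, 0)) has_vector_derivative b + A (s, 0)) (at 0)"
      by (rule b_deriv) (use y c in \<open>auto intro!: has_vector_derivative_Pair\<close>)
    ultimately have "((\<lambda>t. differential (prices n) z (y t) (c t)) has_vector_derivative b + A (s, 0)) (at 0)"
      by (rule has_vector_derivative_transform_nhds[rotated])
    \<comment> \<open>The field takes values in a fixed subspace, hence so does its derivative;
      therefore \<open>A (s, 0)\<close> lies in the image and disappears from the coset.\<close>
    moreover have "s \<in> R"
    proof -
      have "((\<lambda>t. c t $ n) has_vector_derivative s $ n) (at 0)"
        by (rule bounded_linear.has_vector_derivative[OF bounded_linear_vec_nth c(3)])
      moreover have "\<forall>\<^sub>F t in nhds 0. c t $ n = 0"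
        using y(1) c(1) by eventually_elim (auto simp: tangent_space_prices reduced_space_def)
      ultimately have "((\<lambda>t. 0) has_vector_derivative s $ n) (at (0::real))"
        by (rule has_vector_derivative_transform_nhds)
      then show ?thesis
        using vector_derivative_unique_at[OF _ has_vector_derivative_const] by (simp add: reduced_space_def)
    qed
    then have "(b + A (s, 0)) +o Img (prices n) z p = b +o Img (prices n) z p"
      unfolding coset_eq_iff[OF subspaces(1)] unfolding Img_z by auto
    ultimately show "\<exists>d. ((\<lambda>t. differential (prices n) z (y t) (c t)) has_vector_derivative d) (at 0) \<and>
        d +o differential (prices n) z p ` tangent_space (prices n) p = b +o Img (prices n) z p"
      unfolding Img_def by blast
  qed (rule subspace_reduced_space)
  moreover have "intrinsic_second_derivative E endowments \<pi> e (v, 0) (w, 0) = h +o Img E \<pi> e"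
    unfolding intrinsic_second_derivative_def
  proof (rule E.intrinsic_derivative_eqI[where G = UNIV])
    show "e \<in> E" by (rule eq)
    show "(v, 0) \<in> T" "(w, 0) \<in> T" using v' w' by (simp_all add: T_eq)
    then show "differential E \<pi> e (w, 0) = 0" by (simp add: differential_projection)
    show "tangent_space endowments (\<pi> y) = UNIV" if "y \<in> E" for y
      by (rule tangent_space_open[OF open_endowments]) (use E_sub(1)[OF that] in \<open>auto simp: natural_projection_def\<close>)
    fix y c s
    assume y: "\<forall>\<^sub>F t in nhds 0. y t \<in> E" "y 0 = e" "(y has_vector_derivative (v, 0)) (at (0::real))"
      and c: "\<forall>\<^sub>F t in nhds 0. c t \<in> tangent_space E (y t)" "c 0 = (w, 0)"
        "(c has_vector_derivative s) (at 0)"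
    have "((\<lambda>t. snd (c t)) has_vector_derivative snd s) (at 0)"
      by (rule bounded_linear.has_vector_derivative[OF bounded_linear_snd c(3)])
    moreover have "\<forall>\<^sub>F t in nhds 0. snd (c t) = differential E \<pi> (y t) (c t)"
      using c(1) by eventually_elim (simp add: differential_projection)
    ultimately have d: "((\<lambda>t. differential E \<pi> (y t) (c t)) has_vector_derivative snd s) (at 0)"
      by (rule has_vector_derivative_transform_nhds)
    have cT: "\<forall>\<^sub>F t in nhds 0. fst (c t) $ n = 0 \<and> DZr (y t) (c t) = 0"
      using y(1) c(1) by eventually_elim (auto simp: tangent_space_E reduced_space_def)
    have "((\<lambda>t. fst (c t) $ n) has_vector_derivative fst s $ n) (at 0)"
      by (intro bounded_linear.has_vector_derivative[OF bounded_linear_vec_nth]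
          bounded_linear.has_vector_derivative[OF bounded_linear_fst] c(3))
    then have "((\<lambda>t. 0) has_vector_derivative fst s $ n) (at (0::real))"
      by (rule has_vector_derivative_transform_nhds) (use cT in \<open>eventually_elim, simp\<close>)
    then have sR: "fst s \<in> R"
      using vector_derivative_unique_at[OF _ has_vector_derivative_const] by (simp add: reduced_space_def)
    have "((\<lambda>t. DZr (y t) (c t)) has_vector_derivative b + A s) (at 0)"
      by (rule b_deriv) (use y c in auto)
    then have "((\<lambda>t. 0) has_vector_derivative b + A s) (at (0::real))"
      by (rule has_vector_derivative_transform_nhds) (use cT in \<open>eventually_elim, simp\<close>)
    then have "b + A s = 0" using vector_derivative_unique_at[OF _ has_vector_derivative_const] by blast
    then have "A s = - b" by (simp add: eq_neg_iff_add_eq_0 add.commute)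
    \<comment> \<open>\<open>A\<close> sends both \<open>s\<close> and \<open>(0, h)\<close> to
      \<open>- b\<close>; their difference is tangent to \<open>E\<close>, so \<open>snd s\<close>
      and \<open>h\<close> agree modulo the image of the projection.\<close>
    then have "A (fst s, snd s - h) = 0"
      using h A.diff[of s "(0, h)"] by (simp add: minus_prod_def)
    then have "snd s +o Img E \<pi> e = h +o Img E \<pi> e"
      using sR by (auto simp: coset_eq_iff[OF subspaces(2)] mem_Img_projection)
    with d show "\<exists>d. ((\<lambda>t. differential E \<pi> (y t) (c t)) has_vector_derivative d) (at 0) \<and>
        d +o differential E \<pi> e ` T = h +o Img E \<pi> e"
      unfolding Img_def by blast
  qed auto
  ultimately show ?thesis using canonical_map_coset[OF bR h] by simp
qed

end

theorem theorem1p6: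
  fixes u :: "'m::finite \<Rightarrow> real ^ 'l::finite \<Rightarrow> real"
    and n :: 'l
    and p :: "real ^ 'l"
    and \<omega> :: "real ^ 'l ^ 'm"
  assumes "\<And>i. utility_function (u i)"
    and "(p, \<omega>) \<in> equilibrium_manifold u n"
  shows
    "(linear (\<lambda>v::real ^ 'l. (v, 0::real ^ 'l ^ 'm)) \<and>
     bij_betw (\<lambda>v. (v, 0))
       (Ker (prices n) (reduced_excess_demand u n \<omega>) p)
       (Ker (equilibrium_manifold u n) natural_projection (p, \<omega>))) \<and>
     (critical_point (equilibrium_manifold u n) endowments natural_projection (p, \<omega>) \<longleftrightarrow>
     critical_point (prices n) (reduced_space n) (reduced_excess_demand u n \<omega>) p) \<and>
     quotient_iso
       (Img (equilibrium_manifold u n) natural_projection (p, \<omega>))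
       (Coker (equilibrium_manifold u n) endowments natural_projection (p, \<omega>))
       (Img (prices n \<times> endowments) (graph_map u n) (p, \<omega>))
       (Coker (prices n \<times> endowments) (endowments \<times> reduced_space n) (graph_map u n) (p, \<omega>))
       (j1 u n (p, \<omega>)) \<and>
     quotient_iso
       (Img (prices n) (reduced_excess_demand u n \<omega>) p)
       (Coker (prices n) (reduced_space n) (reduced_excess_demand u n \<omega>) p)
       (Img (prices n \<times> endowments) (graph_map u n) (p, \<omega>))
       (Coker (prices n \<times> endowments) (endowments \<times> reduced_space n) (graph_map u n) (p, \<omega>))
       (j2 u n (p, \<omega>)) \<and>
     quotient_iso
       (Img (prices n) (reduced_excess_demand u n \<omega>) p)
       (Coker (prices n) (reduced_space n) (reduced_excess_demand u n \<omega>) p)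
       (Img (equilibrium_manifold u n) natural_projection (p, \<omega>))
       (Coker (equilibrium_manifold u n) endowments natural_projection (p, \<omega>))
       (canonical_map u n (p, \<omega>)) \<and>
     (\<forall>v \<in> Ker (prices n) (reduced_excess_demand u n \<omega>) p.
     \<forall>w \<in> Ker (prices n) (reduced_excess_demand u n \<omega>) p.
       intrinsic_second_derivative (equilibrium_manifold u n) endowments natural_projection
         (p, \<omega>) (v, 0) (w, 0) =
       canonical_map u n (p, \<omega>)
         (intrinsic_second_derivative (prices n) (reduced_space n) (reduced_excess_demand u n \<omega>) p v w))"
proof -
  interpret equilibrium u n p \<omega>
    using assms by unfold_locales
  have "linear (\<lambda>v::real ^ 'l. (v, 0::real ^ 'l ^ 'm))" by (rule linearI) auto
  moreover have "bij_betw (\<lambda>v. (v, 0)) (Ker (prices n) z p) (Ker E \<pi> e)"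
    unfolding Ker_projection by (auto simp: bij_betw_def inj_on_def)
  ultimately show ?thesis
    using critical_iff j1_iso j2_iso canonical_iso second_derivatives by blast
qed

end
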